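(* Let $j$ be an almost complex structure on a smooth manifold $M$ and let $\mathcal{D}$ be a real generalized involutive distribution on $M$ which is stable under $j$. Then $j$ defines a complex $\mathcal{D}$-transverse structure if and only if $$\mathcal{T}_j^{1,0}+\mathcal{D}=\mathcal{T}_j^{1,0}\oplus A^-(\mathcal{D})=\mathcal{T}_j^{1,0}+\mathcal{D}^{\mathbb C}$$ is involutive. In that case $\mathcal{D}\supset\mathcal{D}_j^\infty=\bigcup_k\mathcal{D}_j^{(k)}\supset\mathrm{Im}\,N^j$ (the last inclusion being understood for the sections of $\mathrm{Im}\,N^j$).
   Context: An almost complex structure $j$ on $M$ is a smooth section of $\mathrm{End}(TM)$ with $j^2=-\mathrm{Id}$. $\mathfrak{X}(M)$ is the Lie algebra of smooth real vector fields; $TM^{\mathbb C}=T_j^{1,0}\oplus T_j^{0,1}$ is the splitting into $\pm i$ eigenbundles of $j$; $\mathcal{T}_j^{1,0}$ is the space of smooth sections of $T_j^{1,0}$. For $X\in\mathfrak{X}(M)$, $A^-(X)=\frac12(X+ijX)$, a section of $T_j^{0,1}$. For a space $\mathcal{D}$ of real vector fields, $\mathcal{D}^{\mathbb C}=\mathcal{D}+i\mathcal{D}$. A space of vector fields is involutive if it is closed under the bracket of vector fields. A smooth real distribution $D$ assigns to each $x\in M$ a subspace $D_x\subset T_xM$ (not necessarily of constant dimension) such that near any point there are finitely many smooth vector fields whose values linearly generate $D$ at every point of the neighborhood; $\Gamma^\infty(D)$ is the space of smooth vector fields with values in $D$. A real generalized involutive distribution $\mathcal{D}$ is either $\mathcal{D}=\Gamma^\infty(D)$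 with $D$ a smooth real involutive distribution (that is, $\Gamma^\infty(D)$ is closed under brackets), or an involutive limit $\mathcal{D}=\bigcup_k\mathcal{D}^{(k)}$ of nested spaces of sections $\mathcal{D}^{(k)}=\Gamma^\infty(D^{(k)})$ with $D^{(k)}$ smooth real distributions and $\mathcal{D}^{(k)}+[\mathcal{D}^{(k)},\mathcal{D}^{(k)}]\subset\mathcal{D}^{(k+1)}$. It is stable under $j$ if $j\mathcal{D}\subset\mathcal{D}$. The Nijenhuis tensor is $N^j(X,Y)=[jX,jY]-j[jX,Y]-j[X,jY]-[X,Y]$. For $\mathcal{D}$ stable under $j$, "$j$ defines a complex $\mathcal{D}$-transverse structure" means: $[F,jU]-j[F,U]\in\mathcal{D}$ for all $F\in\mathcal{D}$, $U\in\mathfrak{X}(M)$, and $N^j(U,V)\in\mathcal{D}$ for all $U,V\in\mathfrak{X}(M)$. The image distribution $\mathrm{Im}\,N^j$ is the smooth distribution (possibly of non-constant dimension) whose value at $x\in M$ is the subspace of $T_xM$ spanned by all values $N^j_x(X,Y)$; $\mathcal{I}m\,N^j=\Gamma^\infty(\mathrm{Im}\,N^j)$ denotes the space of its smooth sections. The real smooth distributions $\mathcal{D}_j^{(k)}$, $k\ge1$ (given through their spaces of sections), are defined by $\mathcal{D}_j^{(1)}=\mathcal{I}m\,N^j$ and inductively $\mathcal{D}_j^{(k+1)}=\mathcal{D}_j^{(k)}+\sum_{U\in\mathcal{D}_j^{(k)}}\mathcal{I}m\,\mathcal{L}_Uj+[\mathcal{D}_j^{(k)},\mathcal{D}_j^{(k)}]$,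 where $(\mathcal{L}_Uj)X=[U,jX]-j[U,X]$ and $\mathcal{I}m\,\mathcal{L}_Uj=\{(\mathcal{L}_Uj)X:X\in\mathfrak{X}(M)\}$; $[\cdot,\cdot]$ of two spaces means the linear span of brackets. *)

theory Defs
  imports
    "HOL-Analysis.Analysis"
    "HOL-Library.Function_Algebras"
    "HOL-Library.Set_Algebras"
begin

section \<open>Functions as a real vector space\<close>

text \<open>Tangent vectors and vector fields will be functions with pointwise operations; this instance
  makes \<^const>\<open>subspace\<close> and \<^const>\<open>span\<close> available for them. Sums \<open>A + B\<close> of sets are the elementwise
  sums of \<^theory>\<open>HOL-Library.Set_Algebras\<close>.\<close>

instantiation "fun" :: (type, real_vector) real_vector
begin

definition scaleR_fun_def: "r *\<^sub>R f = (\<lambda>x. r *\<^sub>R f x)"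

instance
  by standard (simp_all add: scaleR_fun_def fun_eq_iff scaleR_add_right scaleR_add_left)

end

lemma scaleR_fun_apply [simp]: "(r *\<^sub>R f) x = r *\<^sub>R f x"
  by (simp add: scaleR_fun_def)


section \<open>Smooth manifolds\<close>

primrec Ck_on :: "nat \<Rightarrow> ('e::euclidean_space \<Rightarrow> 'f::real_normed_vector) \<Rightarrow> 'e set \<Rightarrow> bool" where
  "Ck_on 0 f S \<longleftrightarrow> continuous_on S f"
| "Ck_on (Suc k) f S \<longleftrightarrow> (\<forall>x\<in>S. f differentiable (at x)) \<and>
     (\<forall>v. Ck_on k (\<lambda>x. frechet_derivative f (at x) v) S)"

definition smooth_on :: "('e::euclidean_space \<Rightarrow> 'f::real_normed_vector) \<Rightarrow> 'e set \<Rightarrow> bool" where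
  "smooth_on f S \<longleftrightarrow> (\<forall>k. Ck_on k f S)"

text \<open>A chart \<open>(U, \<phi>)\<close> consists of its domain and its coordinate map. The values of \<open>\<phi>\<close> outside \<open>U\<close>
  are irrelevant; the inverse of the chart is \<open>inv_into U \<phi>\<close>.\<close>

type_synonym ('m, 'e) chart = "'m set \<times> ('m \<Rightarrow> 'e)"

text \<open>The manifold is the whole (Hausdorff, second countable) type \<open>'m\<close>, modelled on the Euclidean
  space \<open>'e\<close>; its smooth structure is the one given by the atlas \<open>A\<close>, which need not be maximal.\<close>

definition smooth_atlas ::
    "('m::{t2_space, second_countable_topology}, 'e::euclidean_space) chart set \<Rightarrow> bool" where
  "smooth_atlas A \<longleftrightarrow>
     (\<Union>(U, \<phi>)\<in>A. U) = UNIV \<and>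
     (\<forall>(U, \<phi>)\<in>A. open U \<and> open (\<phi> ` U) \<and> homeomorphism U (\<phi> ` U) \<phi> (inv_into U \<phi>)) \<and>
     (\<forall>(U, \<phi>)\<in>A. \<forall>(V, \<psi>)\<in>A. smooth_on (\<psi> \<circ> inv_into U \<phi>) (\<phi> ` (U \<inter> V)))"

text \<open>\<open>S\<close> is meant to be open.\<close>

definition smooth_fun_on ::
    "('m::topological_space, 'e::euclidean_space) chart set \<Rightarrow> 'm set \<Rightarrow> ('m \<Rightarrow> real) \<Rightarrow> bool" where
  "smooth_fun_on A S f \<longleftrightarrow> (\<forall>(U, \<phi>)\<in>A. smooth_on (f \<circ> inv_into U \<phi>) (\<phi> ` (U \<inter> S)))"

definition smooth_near ::
    "('m::topological_space, 'e::euclidean_space) chart set \<Rightarrow> 'm \<Rightarrow> ('m \<Rightarrow> real) set" where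
  "smooth_near A x = {f. \<exists>S. open S \<and> x \<in> S \<and> smooth_fun_on A S f}"


section \<open>Tangent vectors and vector fields\<close>

type_synonym 'm tvec = "('m \<Rightarrow> real) \<Rightarrow> real"
type_synonym 'm vfield = "'m \<Rightarrow> 'm tvec"

text \<open>Tangent vectors at \<open>x\<close> are the derivations at \<open>x\<close> of the functions that are smooth near \<open>x\<close>. (Such
  a derivation only depends on germs, as one sees from the Leibniz rule and indicator functions of
  neighbourhoods of \<open>x\<close>.) The value \<open>0\<close> on all other functions is a convention which makes equality of
  tangent vectors equality of functions.\<close>

definition tangent_space ::
    "('m::topological_space, 'e::euclidean_space) chart set \<Rightarrow> 'm \<Rightarrow> 'm tvec set" where
  "tangent_space A x = {v.
     (\<forall>f\<in>smooth_near A x. \<forall>g\<in>smooth_near A x.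
        v (\<lambda>y. f y + g y) = v f + v g \<and> v (\<lambda>y. f y * g y) = f x * v g + g x * v f) \<and>
     (\<forall>f\<in>smooth_near A x. \<forall>c. v (\<lambda>y. c * f y) = c * v f) \<and>
     (\<forall>f. f \<notin> smooth_near A x \<longrightarrow> v f = 0)}"

text \<open>The directional derivative at \<open>x\<close>, in the chart \<open>(U, \<phi>)\<close>, along \<open>b\<close>; for \<open>b\<close> in the standard basis
  these are the coordinate vectors \<open>\<partial>\<^sub>b\<close>.\<close>

definition coord_vector ::
    "('m::topological_space, 'e::euclidean_space) chart set \<Rightarrow> ('m, 'e) chart \<Rightarrow> 'e \<Rightarrow> 'm vfield" where
  "coord_vector A c b x f =
     (case c of (U, \<phi>) \<Rightarrow>
        if f \<in> smooth_near A x then frechet_derivative (f \<circ> inv_into U \<phi>) (at (\<phi> x)) b else 0)"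

text \<open>A vector field is smooth if its components \<open>X\<^sup>b = X \<phi>\<^sup>b\<close> in every chart are smooth. For an open set
  \<open>S \<noteq> UNIV\<close> the values outside \<open>S\<close> are unconstrained.\<close>

definition vector_fields_on ::
    "('m::topological_space, 'e::euclidean_space) chart set \<Rightarrow> 'm set \<Rightarrow> 'm vfield set" where
  "vector_fields_on A S = {X.
     (\<forall>x\<in>S. X x \<in> tangent_space A x) \<and>
     (\<forall>(U, \<phi>)\<in>A. \<forall>b\<in>Basis. smooth_fun_on A (U \<inter> S) (\<lambda>x. X x (\<lambda>y. \<phi> y \<bullet> b)))}"

abbreviation vector_fields ::
    "('m::topological_space, 'e::euclidean_space) chart set \<Rightarrow> 'm vfield set" where
  "vector_fields A \<equiv> vector_fields_on A UNIV"

definition lie_bracket ::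
    "('m::topological_space, 'e::euclidean_space) chart set \<Rightarrow> 'm vfield \<Rightarrow> 'm vfield \<Rightarrow> 'm vfield" where
  "lie_bracket A X Y = (\<lambda>x f.
     if f \<in> smooth_near A x then X x (\<lambda>y. Y y f) - Y x (\<lambda>y. X y f) else 0)"

definition bracket_span ::
    "('m::topological_space, 'e::euclidean_space) chart set \<Rightarrow> 'm vfield set \<Rightarrow> 'm vfield set \<Rightarrow> 'm vfield set"
  where "bracket_span A P Q = span {lie_bracket A X Y | X Y. X \<in> P \<and> Y \<in> Q}"

definition involutive ::
    "('m::topological_space, 'e::euclidean_space) chart set \<Rightarrow> 'm vfield set \<Rightarrow> bool" where
  "involutive A P \<longleftrightarrow> (\<forall>X\<in>P. \<forall>Y\<in>P. lie_bracket A X Y \<in> P)"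


section \<open>Distributions\<close>

definition smooth_distribution ::
    "('m::topological_space, 'e::euclidean_space) chart set \<Rightarrow> ('m \<Rightarrow> 'm tvec set) \<Rightarrow> bool" where
  "smooth_distribution A \<Delta> \<longleftrightarrow>
     (\<forall>x. subspace (\<Delta> x) \<and> \<Delta> x \<subseteq> tangent_space A x) \<and>
     (\<forall>p. \<exists>S G. open S \<and> p \<in> S \<and> finite G \<and> G \<subseteq> vector_fields_on A S \<and>
        (\<forall>x\<in>S. \<Delta> x = span ((\<lambda>X. X x) ` G)))"

definition sections ::
    "('m::topological_space, 'e::euclidean_space) chart set \<Rightarrow> ('m \<Rightarrow> 'm tvec set) \<Rightarrow> 'm vfield set" where
  "sections A \<Delta> = {X \<in> vector_fields A. \<forall>x. X x \<in> \<Delta> x}"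

definition involutive_limit ::
    "('m::topological_space, 'e::euclidean_space) chart set \<Rightarrow> 'm vfield set \<Rightarrow> bool" where
  "involutive_limit A \<D> \<longleftrightarrow> (\<exists>\<Delta> :: nat \<Rightarrow> 'm \<Rightarrow> 'm tvec set.
     (\<forall>k. smooth_distribution A (\<Delta> k)) \<and>
     (\<forall>k. sections A (\<Delta> k) + bracket_span A (sections A (\<Delta> k)) (sections A (\<Delta> k))
            \<subseteq> sections A (\<Delta> (Suc k))) \<and>
     \<D> = (\<Union>k. sections A (\<Delta> k)))"

definition generalized_involutive_distribution ::
    "('m::topological_space, 'e::euclidean_space) chart set \<Rightarrow> 'm vfield set \<Rightarrow> bool" where
  "generalized_involutive_distribution A \<D> \<longleftrightarrow>
     (\<exists>\<Delta>. smooth_distribution A \<Delta> \<and> involutive A (sections A \<Delta>) \<and> \<D> = sections A \<Delta>) \<or>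
     involutive_limit A \<D>"


section \<open>Almost complex structures\<close>

text \<open>A field of endomorphisms; only the values \<open>J x v\<close> with \<open>v\<close> tangent at \<open>x\<close> matter.\<close>

type_synonym 'm endo_field = "'m \<Rightarrow> 'm tvec \<Rightarrow> 'm tvec"

text \<open>Smoothness of \<open>J\<close> is smoothness of its matrix coefficients in every chart.\<close>

definition almost_complex_structure ::
    "('m::topological_space, 'e::euclidean_space) chart set \<Rightarrow> 'm endo_field \<Rightarrow> bool" where
  "almost_complex_structure A J \<longleftrightarrow>
     (\<forall>x. \<forall>v\<in>tangent_space A x.
        J x v \<in> tangent_space A x \<and> J x (J x v) = - v \<and>
        (\<forall>w\<in>tangent_space A x. J x (v + w) = J x v + J x w) \<and>
        (\<forall>c. J x (c *\<^sub>R v) = c *\<^sub>R J x v)) \<and>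
     (\<forall>(U, \<phi>)\<in>A. \<forall>b\<in>Basis. \<forall>b'\<in>Basis.
        smooth_fun_on A U (\<lambda>x. J x (coord_vector A (U, \<phi>) b x) (\<lambda>y. \<phi> y \<bullet> b')))"

definition endo_app :: "'m endo_field \<Rightarrow> 'm vfield \<Rightarrow> 'm vfield" where
  "endo_app J X = (\<lambda>x. J x (X x))"

definition nijenhuis ::
    "('m::topological_space, 'e::euclidean_space) chart set \<Rightarrow> 'm endo_field \<Rightarrow> 'm vfield \<Rightarrow> 'm vfield \<Rightarrow> 'm vfield"
  where
  "nijenhuis A J X Y =
     lie_bracket A (endo_app J X) (endo_app J Y)
     - endo_app J (lie_bracket A (endo_app J X) Y)
     - endo_app J (lie_bracket A X (endo_app J Y))
     - lie_bracket A X Y"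

definition stable_under :: "'m endo_field \<Rightarrow> 'm vfield set \<Rightarrow> bool" where
  "stable_under J \<D> \<longleftrightarrow> endo_app J ` \<D> \<subseteq> \<D>"

definition complex_transverse_structure ::
    "('m::topological_space, 'e::euclidean_space) chart set \<Rightarrow> 'm endo_field \<Rightarrow> 'm vfield set \<Rightarrow> bool" where
  "complex_transverse_structure A J \<D> \<longleftrightarrow>
     (\<forall>F\<in>\<D>. \<forall>U\<in>vector_fields A.
        lie_bracket A F (endo_app J U) - endo_app J (lie_bracket A F U) \<in> \<D>) \<and>
     (\<forall>U\<in>vector_fields A. \<forall>V\<in>vector_fields A. nijenhuis A J U V \<in> \<D>)"

definition nijenhuis_image ::
    "('m::topological_space, 'e::euclidean_space) chart set \<Rightarrow> 'm endo_field \<Rightarrow> 'm \<Rightarrow> 'm tvec set" where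
  "nijenhuis_image A J x =
     span {nijenhuis A J X Y x | X Y. X \<in> vector_fields A \<and> Y \<in> vector_fields A}"

definition lie_derivative_endo ::
    "('m::topological_space, 'e::euclidean_space) chart set \<Rightarrow> 'm vfield \<Rightarrow> 'm endo_field \<Rightarrow> 'm vfield \<Rightarrow> 'm vfield"
  where
  "lie_derivative_endo A U J X = lie_bracket A U (endo_app J X) - endo_app J (lie_bracket A U X)"

text \<open>Indices are shifted: \<open>derived_space A J n\<close> is \<open>\<D>\<^sub>j\<^bsup>(n+1)\<^esup>\<close>. The sum of the subspaces \<open>Im \<L>\<^sub>U j\<close> over all
  \<open>U\<close> is the span of their union.\<close>

primrec derived_space ::
    "('m::topological_space, 'e::euclidean_space) chart set \<Rightarrow> 'm endo_field \<Rightarrow> nat \<Rightarrow> 'm vfield set" where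
  "derived_space A J 0 = sections A (nijenhuis_image A J)"
| "derived_space A J (Suc n) =
     derived_space A J n
     + span (\<Union>U\<in>derived_space A J n. lie_derivative_endo A U J ` vector_fields A)
     + bracket_span A (derived_space A J n) (derived_space A J n)"

definition derived_limit ::
    "('m::topological_space, 'e::euclidean_space) chart set \<Rightarrow> 'm endo_field \<Rightarrow> 'm vfield set" where
  "derived_limit A J = (\<Union>n. derived_space A J n)"


section \<open>Complex vector fields\<close>

text \<open>A complex tangent vector \<open>v + i w\<close> is encoded as the functional \<open>f \<mapsto> v f + i w f\<close> on real functions, so
  that the real and imaginary parts of a complex vector field are read off pointwise.\<close>

type_synonym 'm cvfield = "'m \<Rightarrow> ('m \<Rightarrow> real) \<Rightarrow> complex"

definition mk_cvf :: "'m vfield \<Rightarrow> 'm vfield \<Rightarrow> 'm cvfield" where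
  "mk_cvf X Y = (\<lambda>x f. Complex (X x f) (Y x f))"

definition Re_vf :: "'m cvfield \<Rightarrow> 'm vfield" where
  "Re_vf Z = (\<lambda>x f. Re (Z x f))"

definition Im_vf :: "'m cvfield \<Rightarrow> 'm vfield" where
  "Im_vf Z = (\<lambda>x f. Im (Z x f))"

definition of_real_vf :: "'m vfield \<Rightarrow> 'm cvfield" where
  "of_real_vf X = mk_cvf X 0"

definition cscale_vf :: "complex \<Rightarrow> 'm cvfield \<Rightarrow> 'm cvfield" where
  "cscale_vf c Z = (\<lambda>x f. c * Z x f)"

definition complexification :: "'m vfield set \<Rightarrow> 'm cvfield set" where
  "complexification \<D> = of_real_vf ` \<D> + cscale_vf \<i> ` of_real_vf ` \<D>"

text \<open>The complex-linear extensions of \<open>J\<close> and of the bracket.\<close>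

definition endo_app_complex :: "'m endo_field \<Rightarrow> 'm cvfield \<Rightarrow> 'm cvfield" where
  "endo_app_complex J Z = mk_cvf (endo_app J (Re_vf Z)) (endo_app J (Im_vf Z))"

definition lie_bracket_complex ::
    "('m::topological_space, 'e::euclidean_space) chart set \<Rightarrow> 'm cvfield \<Rightarrow> 'm cvfield \<Rightarrow> 'm cvfield" where
  "lie_bracket_complex A Z W = mk_cvf
     (lie_bracket A (Re_vf Z) (Re_vf W) - lie_bracket A (Im_vf Z) (Im_vf W))
     (lie_bracket A (Re_vf Z) (Im_vf W) + lie_bracket A (Im_vf Z) (Re_vf W))"

definition involutive_complex ::
    "('m::topological_space, 'e::euclidean_space) chart set \<Rightarrow> 'm cvfield set \<Rightarrow> bool" where
  "involutive_complex A P \<longleftrightarrow> (\<forall>Z\<in>P. \<forall>W\<in>P. lie_bracket_complex A Z W \<in> P)"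

definition T10_sections ::
    "('m::topological_space, 'e::euclidean_space) chart set \<Rightarrow> 'm endo_field \<Rightarrow> 'm cvfield set" where
  "T10_sections A J =
     {Z \<in> complexification (vector_fields A). endo_app_complex J Z = cscale_vf \<i> Z}"

definition A_minus :: "'m endo_field \<Rightarrow> 'm vfield \<Rightarrow> 'm cvfield" where
  "A_minus J X = cscale_vf (1/2) (of_real_vf X + cscale_vf \<i> (of_real_vf (endo_app J X)))"

end

theory Submission
  imports Defs
begin

text \<open>
  The equivalence is an algebraic identity. A complex vector field \<open>P + i Q\<close> belongs to \<open>T\<^sup>1\<^sup>,\<^sup>0 + \<D>\<close> if and only if
  \<open>P - j Q \<in> \<D>\<close>, because \<open>A\<^sup>- (P - j Q)\<close> is its \<open>(0,1)\<close>-part and \<open>\<D>\<close> is stable under \<open>j\<close>; the same criterion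
  describes \<open>T\<^sup>1\<^sup>,\<^sup>0 + A\<^sup>-(\<D>)\<close> and \<open>T\<^sup>1\<^sup>,\<^sup>0 + \<D>\<^sup>\<complex>\<close>. For two fields with \<open>P = j Q + F\<close> and \<open>P' = j Q' + F'\<close>, the
  bracket \<open>R + i S\<close> satisfies
  \<open>R - j S = N(Q, Q') + (L\<^sub>F j) Q' - (L\<^bsub>F'\<^esub> j) Q + [F, F']\<close>
  (\<open>bracket_01_part\<close>). The last term lies in \<open>\<D>\<close> by involutivity, and the others lie in \<open>\<D>\<close> for all choices of the
  fields exactly when \<open>j\<close> defines a complex \<open>\<D>\<close>-transverse structure.

  The inclusion of the derived spaces in \<open>\<D>\<close> follows by induction once \<open>\<D>\<close> contains the sections of the image of the
  Nijenhuis tensor. For \<open>\<D> = \<Gamma>(\<Delta>)\<close> this is immediate from \<open>N(X, Y) \<in> \<D>\<close>, pointwise. For an increasing union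
  \<open>\<D> = \<Union>\<^sub>k \<Gamma>(\<Delta>\<^sub>k)\<close> it is the analytic heart of the proof: one needs a single \<open>k\<close> such that \<open>\<Delta>\<^sub>k\<close> contains the image
  of \<open>N\<close> at every point (\<open>nijenhuis_image_in_single_level\<close>). If there were none, points violating the inclusion for
  larger and larger \<open>k\<close> would either cluster, which the local finite generation of the image excludes
  (\<open>nijenhuis_locally_finitely_generated\<close>), or escape to infinity, in which case the violating fields can be glued
  along disjointly supported bumps to one pair \<open>U\<close>, \<open>V\<close> for which \<open>N(U, V)\<close> lies in no level at all
  (\<open>escaping_bumps\<close>, \<open>glue_vector_fields\<close>).

  Everything rests on the elementary calculus of vector fields: real fields form a module over the smooth functions,
  closed under brackets and under \<open>j\<close>, and \<open>N\<close> is bilinear over functions. As tangent vectors are derivations, the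
  bridge to coordinates is Hadamard's lemma (\<open>Hadamard_lemma\<close>, \<open>tangent_expansion\<close>), and cut-offs come from the
  function \<open>e\<^bsup>-1/t\<^esup>\<close> (\<open>exists_bump\<close>, \<open>chart_bump\<close>).
\<close>

section \<open>Calculus of functions of class \<open>C\<^sup>k\<close>\<close>

lemma Ck_on_cong:
  assumes "open S" "\<And>x. x \<in> S \<Longrightarrow> f x = g x" "Ck_on k f S"
  shows "Ck_on k g S"
  using assms(2,3)
proof (induction k arbitrary: f g)
  case 0
  then show ?case by (simp cong: continuous_on_cong)
next
  case (Suc k)
  have D: "(g has_derivative frechet_derivative f (at x)) (at x)" if "x \<in> S" for x
  proof (rule has_derivative_transform_within_open)
    show "(f has_derivative frechet_derivative f (at x)) (at x)"
      using Suc.prems(2) that by (simp add: frechet_derivative_works)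
  qed (use assms(1) that Suc.prems(1) in auto)
  have "Ck_on k (\<lambda>x. frechet_derivative g (at x) v) S" for v
    using Suc.IH[of "\<lambda>x. frechet_derivative f (at x) v" "\<lambda>x. frechet_derivative g (at x) v"]
      Suc.prems(2) frechet_derivative_at[OF D] by auto
  then show ?case
    using D by (auto simp: differentiable_def)
qed

lemma Ck_on_SucI:
  assumes "open S" "\<And>x. x \<in> S \<Longrightarrow> (f has_derivative D x) (at x)" "\<And>v. Ck_on k (\<lambda>x. D x v) S"
  shows "Ck_on (Suc k) f S"
proof -
  have "Ck_on k (\<lambda>x. frechet_derivative f (at x) v) S" for v
    by (rule Ck_on_cong[OF assms(1) _ assms(3)[of v]]) (simp add: frechet_derivative_at[OF assms(2), symmetric])
  then show ?thesis
    using assms(2) by (auto simp: differentiable_def)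
qed

lemma Ck_on_SucD:
  assumes "Ck_on (Suc k) f S"
  shows "Ck_on k f S"
  using assms
proof (induction k arbitrary: f)
  case 0
  then show ?case
    by (simp add: differentiable_imp_continuous_within continuous_at_imp_continuous_on)
next
  case (Suc k)
  then show ?case by (metis Ck_on.simps(2))
qed

lemma Ck_on_subset: "Ck_on k f S \<Longrightarrow> T \<subseteq> S \<Longrightarrow> Ck_on k f T"
  by (induction k arbitrary: f) (auto intro: continuous_on_subset)

text \<open>Smoothness of a function on a manifold will always be checked in small neighbourhoods, so the
  recursive definition of \<open>C\<^sup>k\<close> has to be seen to be local.\<close>

lemma Ck_on_local:
  assumes "\<And>x. x \<in> S \<Longrightarrow> \<exists>T. open T \<and> x \<in> T \<and> Ck_on k f (S \<inter> T)"
  shows "Ck_on k f S"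
  using assms
proof (induction k arbitrary: f)
  case 0
  have "continuous (at x within S) f" if "x \<in> S" for x
  proof -
    obtain T where "open T" "x \<in> T" "continuous_on (S \<inter> T) f"
      using 0[OF \<open>x \<in> S\<close>] by auto
    then have "continuous (at x within S \<inter> T) f"
      using that by (auto simp: continuous_on_eq_continuous_within)
    then show ?thesis
      using at_within_nhd[of x T S "S \<inter> T"] \<open>open T\<close> \<open>x \<in> T\<close> by (simp add: continuous_within)
  qed
  then show ?case by (simp add: continuous_on_eq_continuous_within)
next
  case (Suc k)
  have "Ck_on k (\<lambda>x. frechet_derivative f (at x) v) S" for v
  proof (rule Suc.IH)
    fix x assume "x \<in> S"
    from Suc.prems[OF this] show "\<exists>T. open T \<and> x \<in> T \<and> Ck_on k (\<lambda>x. frechet_derivative f (at x) v) (S \<inter> T)"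
      by (metis Ck_on.simps(2))
  qed
  moreover have "f differentiable (at x)" if "x \<in> S" for x
    using Suc.prems[OF that] that by auto
  ultimately show ?case by simp
qed

lemma Ck_on_const: "open S \<Longrightarrow> Ck_on k (\<lambda>x. c) S"
proof (induction k arbitrary: c)
  case (Suc k)
  show ?case
    by (rule Ck_on_SucI[OF Suc.prems, where D = "\<lambda>x v. 0"]) (use Suc in auto)
qed simp

lemma Ck_on_bounded_linear:
  assumes "bounded_linear L" "open S" 
  shows "Ck_on k f S \<Longrightarrow> Ck_on k (\<lambda>x. L (f x)) S"
proof (induction k arbitrary: f)
  case 0
  then show ?case using bounded_linear.continuous_on[OF assms(1)] by auto
next
  case (Suc k)
  show ?case
  proof (rule Ck_on_SucI[OF assms(2)])
    fix x assume "x \<in> S"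
    then have "(f has_derivative frechet_derivative f (at x)) (at x)"
      using Suc.prems by (simp add: frechet_derivative_works)
    then show "((\<lambda>x. L (f x)) has_derivative (\<lambda>v. L (frechet_derivative f (at x) v))) (at x)"
      by (rule bounded_linear.has_derivative[OF assms(1)])
  qed (use Suc in auto)
qed

lemma Ck_on_id: "open S \<Longrightarrow> Ck_on k (\<lambda>x. x) S"
proof (cases k)
  case (Suc n)
  assume "open S"
  then show ?thesis
    unfolding Suc by (intro Ck_on_SucI[where D = "\<lambda>x v. v"] Ck_on_const) auto
qed simp

lemma Ck_on_add:
  assumes "open S"
  shows "Ck_on k f S \<Longrightarrow> Ck_on k g S \<Longrightarrow> Ck_on k (\<lambda>x. f x + g x) S"
proof (induction k arbitrary: f g)
  case 0
  then show ?case by (auto intro: continuous_intros)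
next
  case (Suc k)
  show ?case
  proof (rule Ck_on_SucI[OF assms])
    fix x assume "x \<in> S"
    then have "(f has_derivative frechet_derivative f (at x)) (at x)"
      "(g has_derivative frechet_derivative g (at x)) (at x)"
      using Suc.prems by (simp_all add: frechet_derivative_works)
    then show "((\<lambda>x. f x + g x) has_derivative
        (\<lambda>v. frechet_derivative f (at x) v + frechet_derivative g (at x) v)) (at x)"
      by (rule has_derivative_add)
  qed (use Suc in auto)
qed

lemma Ck_on_sum:
  assumes "open S" "\<And>i. i \<in> I \<Longrightarrow> Ck_on k (f i) S"
  shows "Ck_on k (\<lambda>x. \<Sum>i\<in>I. f i x) S"
  using assms(2)
  by (induction I rule: infinite_finite_induct) (auto intro: Ck_on_add Ck_on_const assms(1))

lemma Ck_on_scaleR: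
  fixes u :: "'e::euclidean_space \<Rightarrow> real"
  assumes "open S"
  shows "Ck_on k u S \<Longrightarrow> Ck_on k f S \<Longrightarrow> Ck_on k (\<lambda>x. u x *\<^sub>R f x) S"
proof (induction k arbitrary: u f)
  case 0
  then show ?case by (auto intro: continuous_intros)
next
  case (Suc k)
  show ?case
  proof (rule Ck_on_SucI[OF assms])
    fix x assume "x \<in> S"
    then have "(u has_derivative frechet_derivative u (at x)) (at x)"
      "(f has_derivative frechet_derivative f (at x)) (at x)"
      using Suc.prems by (simp_all add: frechet_derivative_works)
    then show "((\<lambda>x. u x *\<^sub>R f x) has_derivative
        (\<lambda>v. u x *\<^sub>R frechet_derivative f (at x) v + frechet_derivative u (at x) v *\<^sub>R f x)) (at x)"
      by (rule has_derivative_scaleR)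
  next
    fix v
    have "Ck_on k u S" "Ck_on k f S"
      using Suc.prems Ck_on_SucD by blast+
    then show "Ck_on k (\<lambda>x. u x *\<^sub>R frechet_derivative f (at x) v + frechet_derivative u (at x) v *\<^sub>R f x) S"
      using Suc by (intro Ck_on_add[OF assms]) auto
  qed
qed

text \<open>By the chain rule \<open>D(f \<circ> g)(x) v = \<Sum>\<^sub>b (Dg(x) v \<bullet> b) D\<^sub>bf(g x)\<close>. Expanding in a basis turns the derivative
  into products of scalar functions with compositions of one order less.\<close>

lemma Ck_on_compose:
  fixes g :: "'e::euclidean_space \<Rightarrow> 'f::euclidean_space"
  assumes "open S" "open T" "g ` S \<subseteq> T"
  shows "Ck_on k f T \<Longrightarrow> Ck_on k g S \<Longrightarrow> Ck_on k (\<lambda>x. f (g x)) S"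
proof (induction k arbitrary: f)
  case 0
  then show ?case using assms(3) continuous_on_compose2[of T f S g] by simp
next
  case (Suc k)
  show ?case
  proof (rule Ck_on_SucI[OF assms(1)])
    fix x assume x: "x \<in> S"
    then have g: "(g has_derivative frechet_derivative g (at x)) (at x)"
      using Suc.prems by (simp add: frechet_derivative_works)
    have f: "(f has_derivative frechet_derivative f (at (g x))) (at (g x))"
      using Suc.prems x assms(3) by (auto simp: frechet_derivative_works)
    interpret linear "frechet_derivative f (at (g x))"
      by (rule has_derivative_linear[OF f])
    have eq: "frechet_derivative f (at (g x)) w =
        (\<Sum>b\<in>Basis. (w \<bullet> b) *\<^sub>R frechet_derivative f (at (g x)) b)" for w
      using arg_cong[OF euclidean_representation[of w], of "frechet_derivative f (at (g x))"]
      by (simp only: sum scale)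
    have comp: "((\<lambda>x. f (g x)) has_derivative
        (\<lambda>v. frechet_derivative f (at (g x)) (frechet_derivative g (at x) v))) (at x)"
      by (rule has_derivative_compose[OF g f])
    show "((\<lambda>x. f (g x)) has_derivative
      (\<lambda>v. \<Sum>b\<in>Basis. (frechet_derivative g (at x) v \<bullet> b) *\<^sub>R frechet_derivative f (at (g x)) b)) (at x)"
      by (rule has_derivative_eq_rhs[OF comp]) (rule ext, rule eq)
  next
    fix v
    have "Ck_on k (\<lambda>x. frechet_derivative f (at (g x)) b) S" for b
      using Suc.IH[of "\<lambda>y. frechet_derivative f (at y) b"] Suc.prems(1) Ck_on_SucD[OF Suc.prems(2)]
      by simp
    moreover have "Ck_on k (\<lambda>x. frechet_derivative g (at x) v \<bullet> b) S" for b
      by (rule Ck_on_bounded_linear[OF bounded_linear_inner_left assms(1)]) (use Suc.prems in auto)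
    ultimately show "Ck_on k (\<lambda>x. \<Sum>b\<in>Basis. (frechet_derivative g (at x) v \<bullet> b) *\<^sub>R
        frechet_derivative f (at (g x)) b) S"
      by (intro Ck_on_sum Ck_on_scaleR assms(1))
  qed
qed

lemma smooth_on_cong:
  "open S \<Longrightarrow> (\<And>x. x \<in> S \<Longrightarrow> f x = g x) \<Longrightarrow> smooth_on f S \<Longrightarrow> smooth_on g S"
  unfolding smooth_on_def by (metis Ck_on_cong)

lemma smooth_on_subset: "smooth_on f S \<Longrightarrow> T \<subseteq> S \<Longrightarrow> smooth_on f T"
  unfolding smooth_on_def by (metis Ck_on_subset)

lemma smooth_on_local:
  assumes "\<And>x. x \<in> S \<Longrightarrow> \<exists>T. open T \<and> x \<in> T \<and> smooth_on f (S \<inter> T)"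
  shows "smooth_on f S"
  unfolding smooth_on_def by (intro allI Ck_on_local) (use assms smooth_on_def in metis)

lemma smooth_on_const: "open S \<Longrightarrow> smooth_on (\<lambda>x. c) S"
  by (simp add: smooth_on_def Ck_on_const)

lemma smooth_on_id: "open S \<Longrightarrow> smooth_on (\<lambda>x. x) S"
  by (simp add: smooth_on_def Ck_on_id)

lemma smooth_on_bounded_linear:
  "bounded_linear L \<Longrightarrow> open S \<Longrightarrow> smooth_on f S \<Longrightarrow> smooth_on (\<lambda>x. L (f x)) S"
  by (simp add: smooth_on_def Ck_on_bounded_linear)

lemma smooth_on_add:
  "open S \<Longrightarrow> smooth_on f S \<Longrightarrow> smooth_on g S \<Longrightarrow> smooth_on (\<lambda>x. f x + g x) S"
  by (simp add: smooth_on_def Ck_on_add)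

lemma smooth_on_sum:
  "open S \<Longrightarrow> (\<And>i. i \<in> I \<Longrightarrow> smooth_on (f i) S) \<Longrightarrow> smooth_on (\<lambda>x. \<Sum>i\<in>I. f i x) S"
  by (simp add: smooth_on_def Ck_on_sum)

lemma smooth_on_mult:
  fixes f g :: "'e::euclidean_space \<Rightarrow> real"
  shows "open S \<Longrightarrow> smooth_on f S \<Longrightarrow> smooth_on g S \<Longrightarrow> smooth_on (\<lambda>x. f x * g x) S"
  using Ck_on_scaleR[of S _ f g] by (simp add: smooth_on_def)

lemma smooth_on_compose:
  fixes g :: "'e::euclidean_space \<Rightarrow> 'f::euclidean_space"
  shows "open S \<Longrightarrow> open T \<Longrightarrow> g ` S \<subseteq> T \<Longrightarrow> smooth_on f T \<Longrightarrow> smooth_on g S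
    \<Longrightarrow> smooth_on (\<lambda>x. f (g x)) S"
  by (simp add: smooth_on_def Ck_on_compose)

lemma smooth_on_has_derivative:
  "smooth_on f S \<Longrightarrow> x \<in> S \<Longrightarrow> (f has_derivative frechet_derivative f (at x)) (at x)"
  unfolding smooth_on_def by (metis Ck_on.simps(2) frechet_derivative_works)

lemma smooth_on_derivative:
  "smooth_on f S \<Longrightarrow> smooth_on (\<lambda>x. frechet_derivative f (at x) v) S"
  unfolding smooth_on_def by (metis Ck_on.simps(2))

lemma smooth_on_continuous_on: "smooth_on f S \<Longrightarrow> continuous_on S f"
  unfolding smooth_on_def by (metis Ck_on.simps(1))

section \<open>Hadamard's lemma\<close>

lemma segment_in_ball:
  fixes a z :: "'e::real_normed_vector"
  assumes "z \<in> ball a r" "t \<in> {0..1}"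
  shows "a + t *\<^sub>R (z - a) \<in> ball a r"
proof -
  have "norm (t *\<^sub>R (z - a)) \<le> 1 * norm (z - a)"
    unfolding norm_scaleR by (intro mult_right_mono) (use assms in auto)
  then show ?thesis using assms(1) by (simp add: dist_norm norm_minus_commute)
qed

text \<open>The coefficient functions of the first-order Taylor expansion at \<open>a\<close> are integrals along rays from \<open>a\<close>.
  Differentiating under the integral sign replaces \<open>h\<close> by \<open>D\<^sub>vh\<close> and produces one more factor \<open>t\<close>; the
  weight \<open>t\<^sup>m\<close> makes the statement stable under this step, so that induction on \<open>k\<close> applies.\<close>

lemma Ck_on_radial_integral:
  fixes h :: "'e::euclidean_space \<Rightarrow> real"
  assumes "smooth_on h (ball a r)"
  shows "Ck_on k (\<lambda>z. integral {0..1} (\<lambda>t. t ^ m * h (a + t *\<^sub>R (z - a)))) (ball a r)"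
  using assms
proof (induction k arbitrary: h m)
  note ray = segment_in_ball[of _ a r]
  have cont: "continuous_on (ball a r \<times> {0..1})
      (\<lambda>(z, t). t ^ m * g (a + t *\<^sub>R (z - a)))" if "smooth_on g (ball a r)" for g :: "'e \<Rightarrow> real" and m
  proof -
    have "continuous_on (ball a r \<times> {0..1}) (\<lambda>p. g (a + snd p *\<^sub>R (fst p - a)))"
      by (rule continuous_on_compose2[OF smooth_on_continuous_on[OF that]])
        (use ray in \<open>auto intro!: continuous_intros\<close>)
    then show ?thesis
      by (auto simp: case_prod_beta intro!: continuous_intros)
  qed
  {
    case 0
    have "continuous_on (ball a r) (\<lambda>z. integral (cbox 0 1) (\<lambda>t. t ^ m * h (a + t *\<^sub>R (z - a))))"
      by (rule integral_continuous_on_param) (use cont[OF 0] in simp)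
    then show ?case by simp
  next
    case (Suc k)
    define D where "D x = frechet_derivative h (at x)" for x
    have hD: "(h has_derivative D x) (at x)" if "x \<in> ball a r" for x
      unfolding D_def by (rule smooth_on_has_derivative[OF Suc.prems that])
    have Dsm: "smooth_on (\<lambda>x. D x v) (ball a r)" for v
      unfolding D_def by (rule smooth_on_derivative[OF Suc.prems])
    \<comment> \<open>the derivative in \<open>z\<close> of the integrand, as the operator-valued function that Leibniz' rule asks for\<close>
    define B where "B z t = Blinfun (\<lambda>v. t ^ Suc m * D (a + t *\<^sub>R (z - a)) v)" for z t
    have B: "blinfun_apply (B z t) v = t ^ Suc m * D (a + t *\<^sub>R (z - a)) v"
      if "z \<in> ball a r" "t \<in> {0..1}" for z t v
      unfolding B_def
      by (subst bounded_linear_Blinfun_apply)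
        (use has_derivative_bounded_linear[OF hD[OF ray[OF that]]] in
          \<open>auto intro: bounded_linear_const_mult\<close>)
    have Bcont: "continuous_on (ball a r \<times> cbox 0 1) (\<lambda>(z, t). B z t)"
    proof (rule continuous_on_blinfun_componentwise)
      fix i :: 'e
      have "continuous_on (ball a r \<times> cbox 0 1) (\<lambda>(z, t). t ^ Suc m * D (a + t *\<^sub>R (z - a)) i)"
        using cont[OF Dsm[of i], of "Suc m"] by simp
      then show "continuous_on (ball a r \<times> cbox 0 1) (\<lambda>p. blinfun_apply (case p of (z, t) \<Rightarrow> B z t) i)"
        by (rule continuous_on_eq) (auto simp: B)
    qed
    have h_line: "((\<lambda>z. t ^ m * h (a + t *\<^sub>R (z - a))) has_derivative B z t) (at z within ball a r)"
      if "z \<in> ball a r" "t \<in> cbox 0 1" for z t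
    proof -
      have "((\<lambda>z. a + t *\<^sub>R (z - a)) has_derivative (\<lambda>v. t *\<^sub>R v)) (at z)"
        by (auto intro!: derivative_eq_intros)
      from has_derivative_compose[OF this hD[OF ray]] that
      have "((\<lambda>z. h (a + t *\<^sub>R (z - a))) has_derivative (\<lambda>v. D (a + t *\<^sub>R (z - a)) (t *\<^sub>R v))) (at z)"
        by simp
      then have "((\<lambda>z. t ^ m * h (a + t *\<^sub>R (z - a))) has_derivative
          (\<lambda>v. t ^ m * D (a + t *\<^sub>R (z - a)) (t *\<^sub>R v))) (at z)"
        by (rule has_derivative_mult_right)
      moreover have "(\<lambda>v. t ^ m * D (a + t *\<^sub>R (z - a)) (t *\<^sub>R v)) = blinfun_apply (B z t)"
      proof
        fix v
        have "D (a + t *\<^sub>R (z - a)) (t *\<^sub>R v) = t * D (a + t *\<^sub>R (z - a)) v"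
          using linear_cmul[OF has_derivative_linear[OF hD[OF ray]]] that by auto
        then show "t ^ m * D (a + t *\<^sub>R (z - a)) (t *\<^sub>R v) = blinfun_apply (B z t) v"
          using that by (simp add: B)
      qed
      ultimately have "((\<lambda>z. t ^ m * h (a + t *\<^sub>R (z - a))) has_derivative B z t) (at z)"
        by simp
      then show ?thesis by (rule has_derivative_at_withinI)
    qed
    show ?case
    proof (rule Ck_on_SucI[OF open_ball])
      fix z assume z: "z \<in> ball a r"
      have int: "(\<lambda>t. t ^ m * h (a + t *\<^sub>R (y - a))) integrable_on cbox 0 1" if "y \<in> ball a r" for y
        by (rule integrable_continuous)
          (rule continuous_on_compose2[OF cont[OF Suc.prems, of m], of _ "\<lambda>t. (y, t)", simplified],
            use that in \<open>auto intro!: continuous_intros\<close>)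
      have Bint: "B z integrable_on cbox 0 1"
        by (rule integrable_continuous)
          (rule continuous_on_compose2[OF Bcont, of _ "\<lambda>t. (z, t)", simplified],
            use z in \<open>auto intro!: continuous_intros\<close>)
      have "((\<lambda>y. integral (cbox 0 1) (\<lambda>t. t ^ m * h (a + t *\<^sub>R (y - a)))) has_derivative
          blinfun_apply (integral (cbox 0 1) (B z))) (at z within ball a r)"
        by (rule leibniz_rule[OF h_line int Bcont z convex_ball])
      moreover have "blinfun_apply (integral (cbox 0 1) (B z)) v =
          integral {0..1} (\<lambda>t. t ^ Suc m * D (a + t *\<^sub>R (z - a)) v)" for v
      proof -
        have "blinfun_apply (integral (cbox 0 1) (B z)) v = integral (cbox 0 1) (\<lambda>t. blinfun_apply (B z t) v)"
          by (rule blinfun_apply_integral[OF Bint])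
        also have "\<dots> = integral {0..1} (\<lambda>t. t ^ Suc m * D (a + t *\<^sub>R (z - a)) v)"
          unfolding box_real by (rule integral_cong) (use z B in auto)
        finally show ?thesis .
      qed
      ultimately show "((\<lambda>y. integral {0..1} (\<lambda>t. t ^ m * h (a + t *\<^sub>R (y - a)))) has_derivative
          (\<lambda>v. integral {0..1} (\<lambda>t. t ^ Suc m * D (a + t *\<^sub>R (z - a)) v))) (at z)"
        unfolding at_within_open[OF z open_ball] box_real
        by (metis (no_types, lifting) ext has_derivative_eq_rhs)
    next
      fix v
      show "Ck_on k (\<lambda>z. integral {0..1} (\<lambda>t. t ^ Suc m * D (a + t *\<^sub>R (z - a)) v)) (ball a r)"
        by (rule Suc.IH[OF Dsm])
    qed
  }
qed

text \<open>The fundamental theorem of calculus on the segment from \<open>a\<close> to \<open>z\<close>, with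
  \<open>h b z = \<integral>\<^sub>0\<^sup>1 D\<^sub>bg(a + t (z - a)) dt\<close>. It makes a derivation at \<open>a\<close> computable: applied to the right-hand
  side it sees only the values \<open>h b a\<close>.\<close>

lemma Hadamard_lemma:
  fixes g :: "'e::euclidean_space \<Rightarrow> real"
  assumes g: "smooth_on g (ball a r)"
  obtains h where "\<And>b. smooth_on (h b) (ball a r)"
    "\<And>z. z \<in> ball a r \<Longrightarrow> g z = g a + (\<Sum>b\<in>Basis. ((z - a) \<bullet> b) * h b z)"
    "\<And>b. 0 < r \<Longrightarrow> h b a = frechet_derivative g (at a) b"
proof
  define D where "D x = frechet_derivative g (at x)" for x
  define h where "h b z = integral {0..1} (\<lambda>t. D (a + t *\<^sub>R (z - a)) b)" for b z
  have Dsm: "smooth_on (\<lambda>x. D x v) (ball a r)" for v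
    unfolding D_def by (rule smooth_on_derivative[OF g])
  have gD: "(g has_derivative D x) (at x)" if "x \<in> ball a r" for x
    unfolding D_def by (rule smooth_on_has_derivative[OF g that])
  show "smooth_on (h b) (ball a r)" for b
    using Ck_on_radial_integral[OF Dsm, of _ 0 b] by (simp add: smooth_on_def h_def[abs_def])
  show "h b a = frechet_derivative g (at a) b" for b
    by (simp add: h_def D_def)
  show "g z = g a + (\<Sum>b\<in>Basis. ((z - a) \<bullet> b) * h b z)" if z: "z \<in> ball a r" for z
  proof -
    note ray = segment_in_ball[OF z]
    have int: "(\<lambda>t. D (a + t *\<^sub>R (z - a)) b) integrable_on {0..1}" for b
      by (intro integrable_continuous_interval
          continuous_on_compose2[OF smooth_on_continuous_on[OF Dsm[of b]]] continuous_intros)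
        (use ray in auto)
    have "((\<lambda>t. D (a + t *\<^sub>R (z - a)) (z - a)) has_integral
        (\<lambda>t. g (a + t *\<^sub>R (z - a))) 1 - (\<lambda>t. g (a + t *\<^sub>R (z - a))) 0) {0..1}"
    proof (rule fundamental_theorem_of_calculus)
      fix t :: real assume t: "t \<in> {0..1}"
      have "((\<lambda>t. a + t *\<^sub>R (z - a)) has_derivative (\<lambda>s. s *\<^sub>R (z - a))) (at t)"
        by (auto intro!: derivative_eq_intros)
      from has_derivative_compose[OF this gD[OF ray[OF t]]]
      have "((\<lambda>t. g (a + t *\<^sub>R (z - a))) has_derivative
          (\<lambda>s. s *\<^sub>R D (a + t *\<^sub>R (z - a)) (z - a))) (at t)"
        using linear_cmul[OF has_derivative_linear[OF gD[OF ray[OF t]]]] by simp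
      then show "((\<lambda>t. g (a + t *\<^sub>R (z - a))) has_vector_derivative
          D (a + t *\<^sub>R (z - a)) (z - a)) (at t within {0..1})"
        unfolding has_vector_derivative_def by (rule has_derivative_at_withinI)
    qed simp
    then have "g z - g a = integral {0..1} (\<lambda>t. D (a + t *\<^sub>R (z - a)) (z - a))"
      by (simp add: integral_unique)
    also have "\<dots> = integral {0..1} (\<lambda>t. \<Sum>b\<in>Basis. ((z - a) \<bullet> b) * D (a + t *\<^sub>R (z - a)) b)"
    proof (rule integral_cong)
      fix t :: real assume t: "t \<in> {0..1}"
      interpret linear "D (a + t *\<^sub>R (z - a))"
        by (rule has_derivative_linear[OF gD[OF ray[OF t]]])
      show "D (a + t *\<^sub>R (z - a)) (z - a) = (\<Sum>b\<in>Basis. ((z - a) \<bullet> b) * D (a + t *\<^sub>R (z - a)) b)"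
        by (subst euclidean_representation[of "z - a", symmetric]) (simp only: sum scale real_scaleR_def)
    qed
    also have "\<dots> = (\<Sum>b\<in>Basis. integral {0..1} (\<lambda>t. ((z - a) \<bullet> b) * D (a + t *\<^sub>R (z - a)) b))"
      by (rule integral_sum) (auto intro: integrable_on_mult_right int)
    also have "\<dots> = (\<Sum>b\<in>Basis. ((z - a) \<bullet> b) * h b z)"
      by (simp add: h_def)
    finally show ?thesis by simp
  qed
qed

section \<open>Bump functions\<close>

text \<open>\<open>flat 0\<close> is the classical smooth function \<open>e\<^bsup>-1/t\<^esup>\<close>, extended by \<open>0\<close> to \<open>t \<le> 0\<close>. The span of the whole
  family is closed under differentiation, which reduces smoothness to differentiability.\<close>

definition flat :: "nat \<Rightarrow> real \<Rightarrow> real" where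
  "flat n t = (if 0 < t then inverse t ^ n * exp (- inverse t) else 0)"

lemma flat_tendsto_0: "(flat n \<longlongrightarrow> 0) (at 0)"
proof -
  have "((\<lambda>t. inverse t ^ n / exp (inverse t)) \<longlongrightarrow> 0) (at_right (0::real))"
    by (rule filterlim_compose[OF tendsto_power_div_exp_0 filterlim_inverse_at_top_right])
  then have "(flat n \<longlongrightarrow> 0) (at_right 0)"
    by (rule Lim_transform_eventually)
      (auto simp: flat_def eventually_at_filter exp_minus field_simps)
  moreover have "(flat n \<longlongrightarrow> 0) (at_left 0)"
    by (rule Lim_transform_eventually[OF tendsto_const])
      (auto simp: flat_def eventually_at_filter)
  ultimately show ?thesis by (simp add: filterlim_at_split)
qed

lemma flat_has_derivative:
  "(flat n has_field_derivative - real n * flat (Suc n) t + flat (Suc (Suc n)) t) (at t)"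
proof -
  consider "0 < t" | "t < 0" | "t = 0" by linarith
  then show ?thesis
  proof cases
    case 1
    have "((\<lambda>t. inverse t ^ n * exp (- inverse t)) has_field_derivative
        - real n * flat (Suc n) t + flat (Suc (Suc n)) t) (at t)"
    proof -
      have "((\<lambda>t. inverse t ^ n) has_field_derivative - real n * inverse t ^ Suc n) (at t)"
      proof (induction n)
        case (Suc n)
        have "(inverse has_field_derivative (- (inverse t ^ 2))) (at t)"
          using 1 DERIV_inverse[of t] by (simp add: numeral_2_eq_2)
        from DERIV_mult[OF this Suc] show ?case
          by (simp add: algebra_simps power2_eq_square)
      qed simp
      moreover have "((\<lambda>t. exp (- inverse t)) has_field_derivative inverse t ^ 2 * exp (- inverse t)) (at t)"
        using 1 by (auto intro!: derivative_eq_intros simp: power2_eq_square)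
      ultimately show ?thesis
        using 1 by (auto dest: DERIV_mult simp: flat_def power2_eq_square mult_ac)
    qed
    then show ?thesis
      by (rule has_field_derivative_transform_within_open[of _ _ _ "{0<..}"])
        (use 1 in \<open>auto simp: flat_def\<close>)
  next
    case 2
    show ?thesis
      by (rule has_field_derivative_transform_within_open[of "\<lambda>_. 0" _ _ "{..<0}"])
        (use 2 in \<open>auto simp: flat_def\<close>)
  next
    case 3
    have "(\<lambda>h. flat n h / h) = flat (Suc n)"
      by (auto simp: flat_def fun_eq_iff divide_inverse)
    then have "(flat n has_field_derivative 0) (at 0)"
      using flat_tendsto_0[of "Suc n"] by (simp add: DERIV_def flat_def[of n 0])
    then show ?thesis using 3 by (simp add: flat_def)
  qed
qed

lemma smooth_on_flat: "smooth_on (flat n) UNIV"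
proof -
  have "Ck_on k (flat n) UNIV" for k
  proof (induction k arbitrary: n)
    case 0
    show ?case
      using DERIV_isCont[OF flat_has_derivative[of n]] by (auto intro!: continuous_at_imp_continuous_on)
  next
    case (Suc k)
    show ?case
    proof (rule Ck_on_SucI)
      show "(flat n has_derivative (\<lambda>v. (- real n * flat (Suc n) t + flat (Suc (Suc n)) t) * v)) (at t)" for t
        using flat_has_derivative by (simp add: has_field_derivative_def)
      have "Ck_on k (\<lambda>t. v *\<^sub>R (- real n *\<^sub>R flat (Suc n) t + flat (Suc (Suc n)) t)) UNIV" for v
        by (intro Ck_on_scaleR Ck_on_add Ck_on_const Suc open_UNIV)
      then show "Ck_on k (\<lambda>t. (- real n * flat (Suc n) t + flat (Suc (Suc n)) t) * v) UNIV" for v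
        by (simp add: mult.commute)
    qed simp
  qed
  then show ?thesis by (simp add: smooth_on_def)
qed

text \<open>\<open>flat 0 (r\<^sup>2 - |z - a|\<^sup>2)\<close>. Only the zero set is controlled: the arguments below divide by
  values of the bump instead of using that it is equal to \<open>1\<close> near \<open>a\<close>.\<close>

lemma exists_bump:
  fixes a :: "'e::euclidean_space"
  assumes "0 < r"
  shows "\<exists>\<beta>::'e \<Rightarrow> real. smooth_on \<beta> UNIV \<and> (\<forall>z. \<beta> z \<noteq> 0 \<longleftrightarrow> z \<in> ball a r)"
proof (intro exI conjI allI)
  let ?\<beta> = "\<lambda>z. flat 0 (r * r + (-1) * (\<Sum>b\<in>Basis. ((z + - a) \<bullet> b) * ((z + - a) \<bullet> b)))"
  have "smooth_on (\<lambda>z. (z + - a) \<bullet> b) UNIV" for b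
    by (intro smooth_on_bounded_linear[OF bounded_linear_inner_left] smooth_on_add smooth_on_id smooth_on_const
        open_UNIV)
  then show "smooth_on ?\<beta> UNIV"
    by (intro smooth_on_compose[OF _ _ _ smooth_on_flat] smooth_on_add smooth_on_mult smooth_on_sum
        smooth_on_const) auto
  fix z
  have "(\<Sum>b\<in>Basis. ((z + - a) \<bullet> b) * ((z + - a) \<bullet> b)) = (dist a z)\<^sup>2"
    using euclidean_inner[of "z - a" "z - a"]
    by (simp add: dist_norm norm_minus_commute[of a z] power2_norm_eq_inner)
  then have "?\<beta> z = flat 0 (r\<^sup>2 - (dist a z)\<^sup>2)"
    by (simp add: power2_eq_square)
  moreover have "dist a z < r \<longleftrightarrow> (dist a z)\<^sup>2 < r\<^sup>2"
    using assms by (meson abs_le_square_iff abs_of_nonneg less_imp_le not_le power2_less_imp_less power_strict_mono zero_le_dist pos2)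
  ultimately show "?\<beta> z \<noteq> 0 \<longleftrightarrow> z \<in> ball a r"
    by (simp add: flat_def)
qed

section \<open>Smooth functions and tangent vectors on a manifold\<close>

lemma sum_fun_apply: "(\<Sum>i\<in>I. f i) x = (\<Sum>i\<in>I. f i x)"
  for f :: "'i \<Rightarrow> 'a \<Rightarrow> 'b::comm_monoid_add"
  by (induction I rule: infinite_finite_induct) auto

locale smooth_manifold =
  fixes A :: "('m::{t2_space, second_countable_topology}, 'e::euclidean_space) chart set"
  assumes atlas: "smooth_atlas A"
begin

lemma chart_exists: "\<exists>U \<phi>. (U, \<phi>) \<in> A \<and> x \<in> U"
proof -
  have "x \<in> (\<Union>(U, \<phi>)\<in>A. U)"
    using atlas by (simp add: smooth_atlas_def)
  then show ?thesis by auto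
qed

lemma chart_open: "(U, \<phi>) \<in> A \<Longrightarrow> open U"
  and chart_homeomorphism: "(U, \<phi>) \<in> A \<Longrightarrow> homeomorphism U (\<phi> ` U) \<phi> (inv_into U \<phi>)"
  and chart_range_open: "(U, \<phi>) \<in> A \<Longrightarrow> open (\<phi> ` U)"
  using atlas by (auto simp: smooth_atlas_def)

lemma chart_transition:
  "(U, \<phi>) \<in> A \<Longrightarrow> (V, \<psi>) \<in> A \<Longrightarrow> smooth_on (\<lambda>z. \<psi> (inv_into U \<phi> z)) (\<phi> ` (U \<inter> V))"
  using atlas by (fastforce simp: smooth_atlas_def comp_def)

lemma chart_inv [simp]: "(U, \<phi>) \<in> A \<Longrightarrow> x \<in> U \<Longrightarrow> inv_into U \<phi> (\<phi> x) = x"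
  using chart_homeomorphism by (auto simp: homeomorphism_def)

lemma chart_inj: "(U, \<phi>) \<in> A \<Longrightarrow> inj_on \<phi> U"
  by (metis chart_inv inj_onI)

lemma chart_continuous: "(U, \<phi>) \<in> A \<Longrightarrow> continuous_on U \<phi>"
  using chart_homeomorphism by (auto simp: homeomorphism_def)

lemma chart_image_open:
  assumes "(U, \<phi>) \<in> A" "open S"
  shows "open (\<phi> ` (U \<inter> S))"
proof -
  have "openin (top_of_set (\<phi> ` U)) (\<phi> ` (U \<inter> S))"
    by (rule homeomorphism_imp_open_map[OF chart_homeomorphism[OF assms(1)]])
      (use assms in \<open>simp add: openin_open_Int\<close>)
  then show ?thesis
    using openin_open_eq[OF chart_range_open[OF assms(1)]] by blast
qed

lemma smooth_fun_onD:
  "smooth_fun_on A S f \<Longrightarrow> (U, \<phi>) \<in> A \<Longrightarrow> smooth_on (\<lambda>z. f (inv_into U \<phi> z)) (\<phi> ` (U \<inter> S))"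
  by (fastforce simp: smooth_fun_on_def comp_def)

lemma smooth_fun_onI:
  "(\<And>U \<phi>. (U, \<phi>) \<in> A \<Longrightarrow> smooth_on (\<lambda>z. f (inv_into U \<phi> z)) (\<phi> ` (U \<inter> S))) \<Longrightarrow> smooth_fun_on A S f"
  by (fastforce simp: smooth_fun_on_def comp_def)

lemma smooth_fun_on_cong:
  assumes "open S" "smooth_fun_on A S f" "\<And>x. x \<in> S \<Longrightarrow> f x = g x"
  shows "smooth_fun_on A S g"
proof (rule smooth_fun_onI)
  fix U \<phi> assume c: "(U, \<phi>) \<in> A"
  show "smooth_on (\<lambda>z. g (inv_into U \<phi> z)) (\<phi> ` (U \<inter> S))"
    by (rule smooth_on_cong[OF chart_image_open[OF c assms(1)] _ smooth_fun_onD[OF assms(2) c]])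
      (use c assms(3) in auto)
qed

lemma smooth_fun_on_subset: "smooth_fun_on A S f \<Longrightarrow> T \<subseteq> S \<Longrightarrow> smooth_fun_on A T f"
  by (rule smooth_fun_onI) (erule (1) smooth_on_subset[OF smooth_fun_onD], blast)

lemma smooth_fun_on_local:
  assumes "\<And>x. x \<in> S \<Longrightarrow> \<exists>T. open T \<and> x \<in> T \<and> smooth_fun_on A (S \<inter> T) f"
  shows "smooth_fun_on A S f"
proof (rule smooth_fun_onI, rule smooth_on_local)
  fix U \<phi> z assume c: "(U, \<phi>) \<in> A" and "z \<in> \<phi> ` (U \<inter> S)"
  then obtain x where x: "x \<in> U" "x \<in> S" "z = \<phi> x" by blast
  obtain T where T: "open T" "x \<in> T" "smooth_fun_on A (S \<inter> T) f"
    using assms x(2) by blast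
  have "\<phi> ` (U \<inter> S) \<inter> \<phi> ` (U \<inter> T) = \<phi> ` (U \<inter> (S \<inter> T))"
    using inj_on_image_Int[OF chart_inj[OF c], of "U \<inter> S" "U \<inter> T"] by (simp add: Int_ac)
  then show "\<exists>W. open W \<and> z \<in> W \<and> smooth_on (\<lambda>z. f (inv_into U \<phi> z)) (\<phi> ` (U \<inter> S) \<inter> W)"
    using smooth_fun_onD[OF T(3) c] chart_image_open[OF c T(1)] x T(2)
    by (intro exI[of _ "\<phi> ` (U \<inter> T)"]) auto
qed

lemma smooth_fun_on_const: "open S \<Longrightarrow> smooth_fun_on A S (\<lambda>x. c)"
  by (rule smooth_fun_onI) (simp add: smooth_on_const chart_image_open)

lemma smooth_fun_on_add:
  "open S \<Longrightarrow> smooth_fun_on A S f \<Longrightarrow> smooth_fun_on A S g \<Longrightarrow> smooth_fun_on A S (\<lambda>x. f x + g x)"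
  by (rule smooth_fun_onI)
    (simp add: smooth_on_add chart_image_open smooth_fun_onD[of S f] smooth_fun_onD[of S g])

lemma smooth_fun_on_mult:
  "open S \<Longrightarrow> smooth_fun_on A S f \<Longrightarrow> smooth_fun_on A S g \<Longrightarrow> smooth_fun_on A S (\<lambda>x. f x * g x)"
  by (rule smooth_fun_onI)
    (simp add: smooth_on_mult chart_image_open smooth_fun_onD[of S f] smooth_fun_onD[of S g])

lemma smooth_fun_on_diff:
  assumes "open S" "smooth_fun_on A S f" "smooth_fun_on A S g"
  shows "smooth_fun_on A S (\<lambda>x. f x - g x)"
  using smooth_fun_on_add[OF assms(1,2) smooth_fun_on_mult[OF assms(1)
        smooth_fun_on_const[OF assms(1), of "-1"] assms(3)]] by simp

lemma smooth_fun_on_sum: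
  "open S \<Longrightarrow> (\<And>i. i \<in> I \<Longrightarrow> smooth_fun_on A S (f i)) \<Longrightarrow> smooth_fun_on A S (\<lambda>x. \<Sum>i\<in>I. f i x)"
  by (rule smooth_fun_onI, rule smooth_on_sum) (auto simp: chart_image_open smooth_fun_onD[of S "f _"])

text \<open>The compatibility of the charts enters here: smoothness in one chart gives smoothness in all of them.\<close>

lemma smooth_fun_on_chart:
  assumes c: "(U, \<phi>) \<in> A" and S: "open S" "S \<subseteq> U" and g: "smooth_on g (\<phi> ` S)"
  shows "smooth_fun_on A S (\<lambda>y. g (\<phi> y))"
proof (rule smooth_fun_onI)
  fix V \<psi> assume d: "(V, \<psi>) \<in> A"
  have "open (\<phi> ` S)"
    using chart_image_open[OF c S(1)] S(2) by (simp add: Int_absorb1)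
  moreover have "smooth_on (\<lambda>z. \<phi> (inv_into V \<psi> z)) (\<psi> ` (V \<inter> S))"
    by (rule smooth_on_subset[OF chart_transition[OF d c]]) (use S in blast)
  ultimately show "smooth_on (\<lambda>z. g (\<phi> (inv_into V \<psi> z))) (\<psi> ` (V \<inter> S))"
    using d by (intro smooth_on_compose[OF chart_image_open[OF d S(1)] _ _ g]) auto
qed

lemma smooth_fun_on_coordinate:
  assumes "(U, \<phi>) \<in> A"
  shows "smooth_fun_on A U (\<lambda>y. \<phi> y \<bullet> b)"
  by (rule smooth_fun_on_chart[OF assms chart_open[OF assms], of "\<lambda>z. z \<bullet> b"])
    (auto intro!: smooth_on_bounded_linear[OF bounded_linear_inner_left] smooth_on_id chart_range_open[OF assms])

lemma smooth_fun_on_partial_derivative: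
  assumes "(U, \<phi>) \<in> A" "open S" "smooth_fun_on A S f"
  shows "smooth_fun_on A (U \<inter> S) (\<lambda>y. frechet_derivative (f \<circ> inv_into U \<phi>) (at (\<phi> y)) b)"
  using smooth_fun_on_chart[OF assms(1) _ _ smooth_on_derivative[OF smooth_fun_onD[OF assms(3,1)]]]
    chart_open[OF assms(1)] assms(2)
  by (simp add: comp_def open_Int)

lemma smooth_nearI: "open S \<Longrightarrow> x \<in> S \<Longrightarrow> smooth_fun_on A S f \<Longrightarrow> f \<in> smooth_near A x"
  by (auto simp: smooth_near_def)

lemma smooth_nearE:
  assumes "f \<in> smooth_near A x"
  obtains S where "open S" "x \<in> S" "smooth_fun_on A S f"
  using assms by (auto simp: smooth_near_def)

lemma smooth_near_const: "(\<lambda>y. c) \<in> smooth_near A x"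
  by (rule smooth_nearI[OF open_UNIV UNIV_I smooth_fun_on_const[OF open_UNIV]])

lemma smooth_near2:
  assumes "f \<in> smooth_near A x" "g \<in> smooth_near A x"
  obtains S where "open S" "x \<in> S" "smooth_fun_on A S f" "smooth_fun_on A S g"
proof -
  obtain S T where "open S" "x \<in> S" "smooth_fun_on A S f" "open T" "x \<in> T" "smooth_fun_on A T g"
    using assms smooth_nearE by metis
  then show thesis
    by (intro that[of "S \<inter> T"]) (auto intro: smooth_fun_on_subset)
qed

lemma smooth_near_add:
  "f \<in> smooth_near A x \<Longrightarrow> g \<in> smooth_near A x \<Longrightarrow> (\<lambda>y. f y + g y) \<in> smooth_near A x"
  by (erule (1) smooth_near2, rule smooth_nearI) (auto simp: smooth_fun_on_add)

lemma smooth_near_mult: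
  "f \<in> smooth_near A x \<Longrightarrow> g \<in> smooth_near A x \<Longrightarrow> (\<lambda>y. f y * g y) \<in> smooth_near A x"
  by (erule (1) smooth_near2, rule smooth_nearI) (auto simp: smooth_fun_on_mult)

lemma smooth_near_sum:
  "(\<And>i. i \<in> I \<Longrightarrow> f i \<in> smooth_near A x) \<Longrightarrow> (\<lambda>y. \<Sum>i\<in>I. f i y) \<in> smooth_near A x"
  by (induction I rule: infinite_finite_induct) (simp_all add: smooth_near_add smooth_near_const)

lemma smooth_near_coordinate: "(U, \<phi>) \<in> A \<Longrightarrow> x \<in> U \<Longrightarrow> (\<lambda>y. \<phi> y \<bullet> b) \<in> smooth_near A x"
  by (metis smooth_nearI smooth_fun_on_coordinate chart_open)

lemma smooth_near_cong:
  assumes "f \<in> smooth_near A x" "open S" "x \<in> S" "\<And>y. y \<in> S \<Longrightarrow> f y = g y"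
  shows "g \<in> smooth_near A x"
proof -
  obtain T where T: "open T" "x \<in> T" "smooth_fun_on A T f"
    using assms(1) smooth_nearE by metis
  show ?thesis
    by (rule smooth_nearI[of "S \<inter> T"])
      (use T assms in \<open>auto intro: smooth_fun_on_cong[OF _ smooth_fun_on_subset[OF T(3)]]\<close>)
qed

lemma tangent_add:
    "v \<in> tangent_space A x \<Longrightarrow> f \<in> smooth_near A x \<Longrightarrow> g \<in> smooth_near A x
      \<Longrightarrow> v (\<lambda>y. f y + g y) = v f + v g"
  and tangent_mult:
    "v \<in> tangent_space A x \<Longrightarrow> f \<in> smooth_near A x \<Longrightarrow> g \<in> smooth_near A x
      \<Longrightarrow> v (\<lambda>y. f y * g y) = f x * v g + g x * v f"
  and tangent_cmult:
    "v \<in> tangent_space A x \<Longrightarrow> f \<in> smooth_near A x \<Longrightarrow> v (\<lambda>y. c * f y) = c * v f"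
  and tangent_undefined:
    "v \<in> tangent_space A x \<Longrightarrow> f \<notin> smooth_near A x \<Longrightarrow> v f = 0"
  by (simp_all add: tangent_space_def)

lemma tangent_const:
  assumes "v \<in> tangent_space A x"
  shows "v (\<lambda>y. c) = 0"
proof -
  have "v (\<lambda>y. 1 * 1) = 1 * v (\<lambda>y. 1) + 1 * v (\<lambda>y. 1)"
    by (rule tangent_mult[OF assms smooth_near_const smooth_near_const])
  then show ?thesis
    using tangent_cmult[OF assms smooth_near_const, of c 1] by simp
qed

lemma tangent_sum:
  assumes "v \<in> tangent_space A x" "\<And>i. i \<in> I \<Longrightarrow> f i \<in> smooth_near A x"
  shows "v (\<lambda>y. \<Sum>i\<in>I. f i y) = (\<Sum>i\<in>I. v (f i))"
  using assms(2)
  by (induction I rule: infinite_finite_induct)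
    (simp_all add: tangent_const[OF assms(1)] tangent_add[OF assms(1)] smooth_near_sum)

text \<open>The Leibniz rule kills the indicator function \<open>u\<close> of a neighbourhood, as \<open>u * u = u\<close>; multiplying \<open>f\<close> and \<open>g\<close> by
  \<open>u\<close> makes them equal everywhere without changing the value of \<open>v\<close>.\<close>

lemma tangent_local:
  assumes v: "v \<in> tangent_space A x" and f: "f \<in> smooth_near A x"
    and S: "open S" "x \<in> S" "\<And>y. y \<in> S \<Longrightarrow> f y = g y"
  shows "v f = v g"
proof -
  define u :: "'m \<Rightarrow> real" where "u = indicator S"
  have g: "g \<in> smooth_near A x"
    by (rule smooth_near_cong[OF f S])
  have u: "u \<in> smooth_near A x"
    by (rule smooth_near_cong[OF smooth_near_const[of 1] S(1,2)]) (simp add: u_def)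
  have 1: "u x = 1" using S(2) by (simp add: u_def)
  have "(\<lambda>y. u y * u y) = u"
    by (auto simp: u_def indicator_def)
  then have 0: "v u = 0"
    using tangent_mult[OF v u u] 1 by simp
  have "(\<lambda>y. u y * f y) = (\<lambda>y. u y * g y)"
    using S(3) by (auto simp: u_def indicator_def)
  then show ?thesis
    using tangent_mult[OF v u f] tangent_mult[OF v u g] 0 1 by simp
qed

text \<open>A derivation is determined by its values on the coordinates. Hadamard's lemma writes \<open>f\<close> near \<open>x\<close> as a
  constant plus a sum of products \<open>(\<phi>\<^sup>b - \<phi>\<^sup>b x) h\<^sub>b\<close>, and since the first factors vanish at \<open>x\<close>, only
  \<open>v \<phi>\<^sup>b\<close> and \<open>h\<^sub>b x\<close> survive the Leibniz rule.\<close>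

lemma tangent_expansion:
  assumes v: "v \<in> tangent_space A x" and c: "(U, \<phi>) \<in> A" "x \<in> U" and f: "f \<in> smooth_near A x"
  shows "v f = (\<Sum>b\<in>Basis. v (\<lambda>y. \<phi> y \<bullet> b) * frechet_derivative (f \<circ> inv_into U \<phi>) (at (\<phi> x)) b)"
proof -
  obtain S where S: "open S" "x \<in> S" "smooth_fun_on A S f"
    using f smooth_nearE by metis
  define g where "g = f \<circ> inv_into U \<phi>"
  define a where "a = \<phi> x"
  have "open (\<phi> ` (U \<inter> S))" "a \<in> \<phi> ` (U \<inter> S)"
    using chart_image_open[OF c(1) S(1)] c S by (auto simp: a_def)
  then obtain r where r: "0 < r" "ball a r \<subseteq> \<phi> ` (U \<inter> S)"
    using open_contains_ball by metis
  have "smooth_on g (ball a r)"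
    using smooth_on_subset[OF smooth_fun_onD[OF S(3) c(1)] r(2)] by (simp add: g_def comp_def)
  then obtain h where h: "\<And>b. smooth_on (h b) (ball a r)"
      "\<And>z. z \<in> ball a r \<Longrightarrow> g z = g a + (\<Sum>b\<in>Basis. ((z - a) \<bullet> b) * h b z)"
      "\<And>b. h b a = frechet_derivative g (at a) b"
    using Hadamard_lemma[of g a r] r(1) by metis
  define W where "W = U \<inter> \<phi> -` ball a r"
  have W: "open W" "x \<in> W"
    using continuous_open_preimage[OF chart_continuous[OF c(1)] chart_open[OF c(1)] open_ball] c(2) r(1)
    by (auto simp: W_def a_def)
  have hW: "(\<lambda>y. h b (\<phi> y)) \<in> smooth_near A x" for b
    by (rule smooth_nearI[OF W smooth_fun_on_chart[OF c(1) W(1)]])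
      (auto simp: W_def intro: smooth_on_subset[OF h(1)])
  let ?d = "\<lambda>b y. \<phi> y \<bullet> b - a \<bullet> b"
  have d: "?d b \<in> smooth_near A x" for b
    using smooth_near_add[OF smooth_near_coordinate[OF c, of b] smooth_near_const[of "- (a \<bullet> b)"]] by simp
  have vd: "v (?d b) = v (\<lambda>y. \<phi> y \<bullet> b)" for b
    using tangent_add[OF v smooth_near_coordinate[OF c, of b] smooth_near_const[of "- (a \<bullet> b)"]]
    by (simp add: tangent_const[OF v])
  have "v f = v (\<lambda>y. g a + (\<Sum>b\<in>Basis. ?d b y * h b (\<phi> y)))"
  proof (rule tangent_local[OF v f W])
    fix y assume "y \<in> W"
    then have "f y = g (\<phi> y)" "\<phi> y \<in> ball a r"
      using c(1) by (auto simp: W_def g_def)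
    then show "f y = g a + (\<Sum>b\<in>Basis. ?d b y * h b (\<phi> y))"
      using h(2) by (simp add: inner_diff_left)
  qed
  also have "\<dots> = v (\<lambda>y. g a) + v (\<lambda>y. \<Sum>b\<in>Basis. ?d b y * h b (\<phi> y))"
    by (intro tangent_add[OF v] smooth_near_const smooth_near_sum smooth_near_mult d hW)
  also have "\<dots> = (\<Sum>b\<in>Basis. v (\<lambda>y. ?d b y * h b (\<phi> y)))"
    by (subst tangent_sum[OF v smooth_near_mult[OF d hW]]) (simp add: tangent_const[OF v])
  also have "\<dots> = (\<Sum>b\<in>Basis. v (\<lambda>y. \<phi> y \<bullet> b) * h b a)"
    by (rule sum.cong) (simp_all add: tangent_mult[OF v d hW] vd flip: a_def)
  finally show ?thesis
    unfolding h(3) by (simp only: g_def a_def)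
qed

lemma coord_vector_tangent:
  assumes c: "(U, \<phi>) \<in> A" "x \<in> U"
  shows "coord_vector A (U, \<phi>) b x \<in> tangent_space A x"
proof -
  let ?i = "inv_into U \<phi>"
  have D: "((\<lambda>z. f (?i z)) has_derivative frechet_derivative (\<lambda>z. f (?i z)) (at (\<phi> x))) (at (\<phi> x))"
    if f: "f \<in> smooth_near A x" for f
  proof -
    obtain S where "open S" "x \<in> S" "smooth_fun_on A S f"
      using f smooth_nearE by metis
    then show ?thesis
      using smooth_on_has_derivative[OF smooth_fun_onD[OF _ c(1)]] c by auto
  qed
  note D' = frechet_derivative_at[symmetric]
  show ?thesis
    unfolding tangent_space_def
  proof (intro CollectI conjI ballI allI impI)
    fix f g assume f: "f \<in> smooth_near A x" and g: "g \<in> smooth_near A x"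
    show "coord_vector A (U, \<phi>) b x (\<lambda>y. f y + g y) = coord_vector A (U, \<phi>) b x f + coord_vector A (U, \<phi>) b x g"
      using f g smooth_near_add[OF f g] D'[OF has_derivative_add[OF D[OF f] D[OF g]]]
      by (simp add: coord_vector_def comp_def)
    show "coord_vector A (U, \<phi>) b x (\<lambda>y. f y * g y) = f x * coord_vector A (U, \<phi>) b x g + g x * coord_vector A (U, \<phi>) b x f"
      using f g smooth_near_mult[OF f g] D'[OF has_derivative_mult[OF D[OF f] D[OF g]]] c
      by (simp add: coord_vector_def comp_def)
  next
    fix f k assume f: "f \<in> smooth_near A x"
    show "coord_vector A (U, \<phi>) b x (\<lambda>y. k * f y) = k * coord_vector A (U, \<phi>) b x f"
      using f smooth_near_mult[OF smooth_near_const[of k] f] D'[OF has_derivative_mult_right[OF D[OF f], of k]] c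
      by (simp add: coord_vector_def comp_def)
  qed (simp add: coord_vector_def)
qed

text \<open>The coordinate vectors span every tangent space, so that tensorial expressions can be computed in a chart.\<close>

lemma tangent_basis:
  assumes v: "v \<in> tangent_space A x" and c: "(U, \<phi>) \<in> A" "x \<in> U"
  shows "v = (\<Sum>b\<in>Basis. v (\<lambda>y. \<phi> y \<bullet> b) *\<^sub>R coord_vector A (U, \<phi>) b x)"
proof
  fix f
  show "v f = (\<Sum>b\<in>Basis. v (\<lambda>y. \<phi> y \<bullet> b) *\<^sub>R coord_vector A (U, \<phi>) b x) f"
    using tangent_expansion[OF v c, of f] tangent_undefined[OF v, of f]
    by (cases "f \<in> smooth_near A x") (simp_all add: sum_fun_apply coord_vector_def)
qed

lemma subspace_tangent_space: "subspace (tangent_space A x)"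
  unfolding subspace_def tangent_space_def by (auto simp: algebra_simps)

section \<open>Vector fields\<close>

lemma vector_fieldsI:
  assumes "\<And>x. X x \<in> tangent_space A x"
    "\<And>U \<phi> b. (U, \<phi>) \<in> A \<Longrightarrow> b \<in> Basis \<Longrightarrow> smooth_fun_on A U (\<lambda>x. X x (\<lambda>y. \<phi> y \<bullet> b))"
  shows "X \<in> vector_fields A"
  using assms by (auto simp: vector_fields_on_def)

lemma vector_field_tangent: "X \<in> vector_fields A \<Longrightarrow> X x \<in> tangent_space A x"
  by (simp add: vector_fields_on_def)

lemma vector_field_component:
  "X \<in> vector_fields A \<Longrightarrow> (U, \<phi>) \<in> A \<Longrightarrow> b \<in> Basis \<Longrightarrow> smooth_fun_on A U (\<lambda>x. X x (\<lambda>y. \<phi> y \<bullet> b))"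
  by (auto simp: vector_fields_on_def)

lemma smooth_fun_on_vector_field:
  assumes X: "X \<in> vector_fields A" and f: "open S" "smooth_fun_on A S f"
  shows "smooth_fun_on A S (\<lambda>x. X x f)"
proof (rule smooth_fun_on_local)
  fix x assume "x \<in> S"
  obtain U \<phi> where c: "(U, \<phi>) \<in> A" "x \<in> U" using chart_exists by blast
  have U: "open (U \<inter> S)" using chart_open[OF c(1)] f(1) by (rule open_Int)
  have "smooth_fun_on A (U \<inter> S) (\<lambda>x. \<Sum>b\<in>Basis. X x (\<lambda>y. \<phi> y \<bullet> b) *
      frechet_derivative (f \<circ> inv_into U \<phi>) (at (\<phi> x)) b)"
    by (intro smooth_fun_on_sum smooth_fun_on_mult U smooth_fun_on_partial_derivative c f
        smooth_fun_on_subset[OF vector_field_component[OF X c(1)]]) auto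
  then have "smooth_fun_on A (U \<inter> S) (\<lambda>x. X x f)"
  proof (rule smooth_fun_on_cong[OF U])
    fix y assume "y \<in> U \<inter> S"
    then show "(\<Sum>b\<in>Basis. X y (\<lambda>y. \<phi> y \<bullet> b) * frechet_derivative (f \<circ> inv_into U \<phi>) (at (\<phi> y)) b) = X y f"
      using tangent_expansion[OF vector_field_tangent[OF X] c(1) _ smooth_nearI[OF f(1) _ f(2)]] by auto
  qed
  then show "\<exists>T. open T \<and> x \<in> T \<and> smooth_fun_on A (S \<inter> T) (\<lambda>x. X x f)"
    using c chart_open[OF c(1)] by (intro exI[of _ U]) (simp add: Int_commute)
qed

lemma smooth_near_vector_field:
  "X \<in> vector_fields A \<Longrightarrow> f \<in> smooth_near A x \<Longrightarrow> (\<lambda>y. X y f) \<in> smooth_near A x"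
  by (metis smooth_nearE smooth_nearI smooth_fun_on_vector_field)

lemma vector_fields_add:
  assumes "X \<in> vector_fields A" "Y \<in> vector_fields A"
  shows "X + Y \<in> vector_fields A"
  using assms
  by (intro vector_fieldsI)
    (simp_all add: subspace_add[OF subspace_tangent_space] smooth_fun_on_add chart_open
      vector_field_tangent vector_field_component)

lemma vector_fields_mult:
  assumes "X \<in> vector_fields A" "smooth_fun_on A UNIV f"
  shows "(\<lambda>x. f x *\<^sub>R X x) \<in> vector_fields A"
  using assms
  by (intro vector_fieldsI)
    (simp_all add: subspace_scale[OF subspace_tangent_space] smooth_fun_on_mult chart_open
      vector_field_tangent vector_field_component smooth_fun_on_subset[OF assms(2)])

lemma subspace_vector_fields: "subspace (vector_fields A)"
proof (rule subspaceI)
  show "0 \<in> vector_fields A"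
    using subspace_0[OF subspace_tangent_space]
    by (intro vector_fieldsI) (simp_all add: chart_open smooth_fun_on_const)
  show "c *\<^sub>R X \<in> vector_fields A" if "X \<in> vector_fields A" for c X
    using vector_fields_mult[OF that smooth_fun_on_const[OF open_UNIV, of c]] by (simp add: scaleR_fun_def)
qed (rule vector_fields_add)

lemmas vector_fields_diff = subspace_diff[OF subspace_vector_fields]
  and vector_fields_neg = subspace_neg[OF subspace_vector_fields]
  and vector_fields_scaleR = subspace_scale[OF subspace_vector_fields]
  and vector_fields_sum = subspace_sum[OF subspace_vector_fields]

text \<open>In \<open>X (Y (f g))\<close> the mixed terms \<open>(X f)(Y g) + (Y f)(X g)\<close> are symmetric in \<open>X\<close> and \<open>Y\<close> and cancel in the
  commutator. Since \<open>Y (f g)\<close> is given by the Leibniz rule only near \<open>x\<close>, each step needs the locality of \<open>X x\<close>.\<close>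

lemma lie_bracket_tangent:
  assumes X: "X \<in> vector_fields A" and Y: "Y \<in> vector_fields A"
  shows "lie_bracket A X Y x \<in> tangent_space A x"
proof -
  have prod: "Z x (\<lambda>y. W y (\<lambda>y. f y * g y)) =
      f x * Z x (\<lambda>y. W y g) + g x * Z x (\<lambda>y. W y f) + (W x g * Z x f + W x f * Z x g)"
    if f: "f \<in> smooth_near A x" and g: "g \<in> smooth_near A x"
      and Z: "Z \<in> vector_fields A" and W: "W \<in> vector_fields A" for f g Z W
  proof -
    note T = vector_field_tangent[OF Z, of x] and n = smooth_near_vector_field[OF W]
    obtain S where S: "open S" "x \<in> S" "smooth_fun_on A S f" "smooth_fun_on A S g"
      using smooth_near2[OF f g] by metis
    have "Z x (\<lambda>y. f y * W y g + g y * W y f) = Z x (\<lambda>y. W y (\<lambda>y. f y * g y))"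
    proof (rule tangent_local[OF T _ S(1,2)])
      show "f y * W y g + g y * W y f = W y (\<lambda>y. f y * g y)" if "y \<in> S" for y
        using that tangent_mult[OF vector_field_tangent[OF W] smooth_nearI[OF S(1) that S(3)] smooth_nearI[OF S(1) that S(4)]]
        by simp
    qed (intro smooth_near_add smooth_near_mult f g n)
    moreover have "Z x (\<lambda>y. f y * W y g + g y * W y f) = Z x (\<lambda>y. f y * W y g) + Z x (\<lambda>y. g y * W y f)"
      by (intro tangent_add[OF T] smooth_near_mult f g n)
    ultimately show ?thesis
      using tangent_mult[OF T f n[OF g]] tangent_mult[OF T g n[OF f]] by simp
  qed
  have add: "Z x (\<lambda>y. W y (\<lambda>y. f y + g y)) = Z x (\<lambda>y. W y f) + Z x (\<lambda>y. W y g)"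
    if f: "f \<in> smooth_near A x" and g: "g \<in> smooth_near A x"
      and Z: "Z \<in> vector_fields A" and W: "W \<in> vector_fields A" for f g Z W
  proof -
    note T = vector_field_tangent[OF Z, of x] and n = smooth_near_vector_field[OF W]
    obtain S where S: "open S" "x \<in> S" "smooth_fun_on A S f" "smooth_fun_on A S g"
      using smooth_near2[OF f g] by metis
    have "Z x (\<lambda>y. W y f + W y g) = Z x (\<lambda>y. W y (\<lambda>y. f y + g y))"
    proof (rule tangent_local[OF T _ S(1,2)])
      show "W y f + W y g = W y (\<lambda>y. f y + g y)" if "y \<in> S" for y
        using that tangent_add[OF vector_field_tangent[OF W] smooth_nearI[OF S(1) that S(3)] smooth_nearI[OF S(1) that S(4)]]
        by simp
    qed (intro smooth_near_add n f g)
    then show ?thesis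
      using tangent_add[OF T n[OF f] n[OF g]] by simp
  qed
  have scale: "Z x (\<lambda>y. W y (\<lambda>y. k * f y)) = k * Z x (\<lambda>y. W y f)"
    if f: "f \<in> smooth_near A x" and Z: "Z \<in> vector_fields A" and W: "W \<in> vector_fields A" for f k Z W
    using prod[OF smooth_near_const f Z W, of k]
    by (simp add: tangent_const[OF vector_field_tangent[OF Z]] tangent_const[OF vector_field_tangent[OF W]])
  show ?thesis
    unfolding tangent_space_def lie_bracket_def
    by (auto simp: prod add scale X Y smooth_near_add smooth_near_mult smooth_near_const algebra_simps)
qed

lemma lie_bracket_vector_field:
  assumes X: "X \<in> vector_fields A" and Y: "Y \<in> vector_fields A"
  shows "lie_bracket A X Y \<in> vector_fields A"
proof (rule vector_fieldsI)
  fix U \<phi> b assume c: "(U, \<phi>) \<in> A"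
  let ?f = "\<lambda>y. \<phi> y \<bullet> b"
  note U = chart_open[OF c] and s = smooth_fun_on_vector_field and f = smooth_fun_on_coordinate[OF c, of b]
  have "smooth_fun_on A U (\<lambda>x. X x (\<lambda>y. Y y ?f) - Y x (\<lambda>y. X y ?f))"
    by (rule smooth_fun_on_diff[OF U s[OF X U s[OF Y U f]] s[OF Y U s[OF X U f]]])
  then show "smooth_fun_on A U (\<lambda>x. lie_bracket A X Y x ?f)"
    by (rule smooth_fun_on_cong[OF U]) (simp add: lie_bracket_def smooth_near_coordinate[OF c])
qed (rule lie_bracket_tangent[OF X Y])

lemma lie_bracket_antisym: "lie_bracket A Y X = - lie_bracket A X Y"
  by (intro ext) (simp add: lie_bracket_def)

lemma lie_bracket_add_left:
  assumes "X \<in> vector_fields A" "Y \<in> vector_fields A" "Z \<in> vector_fields A"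
  shows "lie_bracket A (X + Y) Z = lie_bracket A X Z + lie_bracket A Y Z"
proof (intro ext)
  fix x f
  show "lie_bracket A (X + Y) Z x f = (lie_bracket A X Z + lie_bracket A Y Z) x f"
    using tangent_add[OF vector_field_tangent[OF assms(3)] smooth_near_vector_field[OF assms(1)]
        smooth_near_vector_field[OF assms(2)], of f x f]
    by (cases "f \<in> smooth_near A x") (simp_all add: lie_bracket_def)
qed

text \<open>The bracket is not tensorial; the derivative term \<open>(Y h) X\<close> is what has to cancel in the Nijenhuis tensor.\<close>

lemma lie_bracket_mult_left:
  assumes X: "X \<in> vector_fields A" and Y: "Y \<in> vector_fields A" and h: "smooth_fun_on A UNIV h"
  shows "lie_bracket A (\<lambda>x. h x *\<^sub>R X x) Y =
    (\<lambda>x. h x *\<^sub>R lie_bracket A X Y x) - (\<lambda>x. Y x h *\<^sub>R X x)"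
proof (intro ext)
  fix x f
  have "h \<in> smooth_near A x" using h by (intro smooth_nearI[of UNIV]) auto
  then show "lie_bracket A (\<lambda>x. h x *\<^sub>R X x) Y x f =
    ((\<lambda>x. h x *\<^sub>R lie_bracket A X Y x) - (\<lambda>x. Y x h *\<^sub>R X x)) x f"
    using tangent_undefined[OF vector_field_tangent[OF X], of f x]
    by (cases "f \<in> smooth_near A x")
      (simp_all add: lie_bracket_def tangent_mult[OF vector_field_tangent[OF Y]]
        smooth_near_vector_field[OF X] algebra_simps)
qed

lemma lie_bracket_scaleR_left:
  assumes X: "X \<in> vector_fields A" and Y: "Y \<in> vector_fields A"
  shows "lie_bracket A (c *\<^sub>R X) Y = c *\<^sub>R lie_bracket A X Y"
  using lie_bracket_mult_left[OF X Y smooth_fun_on_const[OF open_UNIV, of c]]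
  by (simp add: tangent_const[OF vector_field_tangent[OF Y]] scaleR_fun_def fun_eq_iff)

lemma lie_bracket_add_right:
  "X \<in> vector_fields A \<Longrightarrow> Y \<in> vector_fields A \<Longrightarrow> Z \<in> vector_fields A
    \<Longrightarrow> lie_bracket A Z (X + Y) = lie_bracket A Z X + lie_bracket A Z Y"
  using lie_bracket_add_left[of X Y Z] by (simp add: lie_bracket_antisym[of Z])

section \<open>Generalized involutive distributions\<close>

lemma subspace_sections:
  assumes "\<And>x. subspace (\<Delta> x)"
  shows "subspace (sections A \<Delta>)"
  using assms subspace_vector_fields unfolding sections_def subspace_def by auto

text \<open>The two kinds of generalized involutive distributions are treated together: an involutive distribution is the
  limit of the constant sequence.\<close>

lemma generalized_involutive_distributionE:
  assumes "generalized_involutive_distribution A \<D>"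
  obtains \<Delta> :: "nat \<Rightarrow> 'm \<Rightarrow> 'm tvec set"
  where "\<And>k x. subspace (\<Delta> k x)" "mono (\<lambda>k. sections A (\<Delta> k))"
    "\<And>k X Y. X \<in> sections A (\<Delta> k) \<Longrightarrow> Y \<in> sections A (\<Delta> k)
      \<Longrightarrow> lie_bracket A X Y \<in> sections A (\<Delta> (Suc k))"
    "\<D> = (\<Union>k. sections A (\<Delta> k))"
  using assms unfolding generalized_involutive_distribution_def
proof (elim disjE exE conjE)
  fix \<Delta> assume "smooth_distribution A \<Delta>" "involutive A (sections A \<Delta>)" "\<D> = sections A \<Delta>"
  then show thesis
    by (intro that[of "\<lambda>_. \<Delta>"]) (auto simp: smooth_distribution_def involutive_def mono_def)
next
  assume "involutive_limit A \<D>"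
  then obtain \<Delta> where \<Delta>: "\<And>k. smooth_distribution A (\<Delta> k)" "\<D> = (\<Union>k. sections A (\<Delta> k))"
    and step: "\<And>k. sections A (\<Delta> k) + bracket_span A (sections A (\<Delta> k)) (sections A (\<Delta> k)) \<subseteq> sections A (\<Delta> (Suc k))"
    unfolding involutive_limit_def by blast
  have sub: "subspace (\<Delta> k x)" for k x
    using \<Delta>(1) by (simp add: smooth_distribution_def)
  have in_step: "X + Y \<in> sections A (\<Delta> (Suc k))"
    if "X \<in> sections A (\<Delta> k)" "Y \<in> bracket_span A (sections A (\<Delta> k)) (sections A (\<Delta> k))" for k X Y
    using set_plus_intro[OF that] step by blast
  show thesis
  proof (rule that[of \<Delta>, OF sub _ _ \<Delta>(2)])
    have "sections A (\<Delta> k) \<subseteq> sections A (\<Delta> (Suc k))" for k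
      using in_step[of _ k 0] by (auto simp: bracket_span_def span_zero)
    then show "mono (\<lambda>k. sections A (\<Delta> k))"
      by (simp add: mono_iff_le_Suc)
    fix k X Y assume XY: "X \<in> sections A (\<Delta> k)" "Y \<in> sections A (\<Delta> k)"
    have "lie_bracket A X Y \<in> bracket_span A (sections A (\<Delta> k)) (sections A (\<Delta> k))"
      unfolding bracket_span_def using XY by (intro span_base) auto
    then show "lie_bracket A X Y \<in> sections A (\<Delta> (Suc k))"
      using in_step[OF subspace_0[OF subspace_sections[OF sub]]] by simp
  qed
qed

lemma generalized_involutive_distributionD:
  assumes "generalized_involutive_distribution A \<D>"
  shows "subspace \<D>" "\<D> \<subseteq> vector_fields A" "involutive A \<D>"
proof -
  obtain \<Delta> :: "nat \<Rightarrow> 'm \<Rightarrow> 'm tvec set"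
    where sub: "\<And>k x. subspace (\<Delta> k x)" and mono: "mono (\<lambda>k. sections A (\<Delta> k))"
    and bracket: "\<And>k X Y. X \<in> sections A (\<Delta> k) \<Longrightarrow> Y \<in> sections A (\<Delta> k)
      \<Longrightarrow> lie_bracket A X Y \<in> sections A (\<Delta> (Suc k))"
    and \<D>: "\<D> = (\<Union>k. sections A (\<Delta> k))"
    by (rule generalized_involutive_distributionE[OF assms]) (rule that)
  have common: "\<exists>k. X \<in> sections A (\<Delta> k) \<and> Y \<in> sections A (\<Delta> k)" if "X \<in> \<D>" "Y \<in> \<D>" for X Y
  proof -
    obtain k l where kl: "X \<in> sections A (\<Delta> k)" "Y \<in> sections A (\<Delta> l)"
      using \<open>X \<in> \<D>\<close> \<open>Y \<in> \<D>\<close> \<D> by blast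
    have "sections A (\<Delta> k) \<subseteq> sections A (\<Delta> (max k l))" "sections A (\<Delta> l) \<subseteq> sections A (\<Delta> (max k l))"
      using monoD[OF mono] max.cobounded1 max.cobounded2 by metis+
    then show ?thesis
      using kl by blast
  qed
  note sec = subspace_sections[OF sub]
  show "subspace \<D>"
  proof (rule subspaceI)
    show "0 \<in> \<D>" using subspace_0[OF sec] by (simp add: \<D>)
    show "X + Y \<in> \<D>" if XY: "X \<in> \<D>" "Y \<in> \<D>" for X Y
    proof -
      obtain k where "X \<in> sections A (\<Delta> k)" "Y \<in> sections A (\<Delta> k)"
        using common[OF XY] by metis
      from subspace_add[OF sec this] show ?thesis by (auto simp: \<D>)
    qed
    show "c *\<^sub>R X \<in> \<D>" if X: "X \<in> \<D>" for X c
    proof -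
      obtain k where "X \<in> sections A (\<Delta> k)"
        using X by (auto simp: \<D>)
      from subspace_scale[OF sec this] show ?thesis by (auto simp: \<D>)
    qed
  qed
  show "involutive A \<D>"
    unfolding involutive_def
  proof (intro ballI)
    fix X Y assume "X \<in> \<D>" "Y \<in> \<D>"
    then obtain k where "X \<in> sections A (\<Delta> k)" "Y \<in> sections A (\<Delta> k)"
      using common by metis
    then show "lie_bracket A X Y \<in> \<D>"
      using bracket \<D> by auto
  qed
  show "\<D> \<subseteq> vector_fields A"
    using \<D> by (auto simp: sections_def)
qed

section \<open>Cut-offs and locally finite sums\<close>

text \<open>\<open>U\<close> and the complement of \<open>K\<close> form an open cover, and the extended function vanishes on the latter.\<close>

lemma smooth_fun_on_extend_by_zero:
  assumes "open U" "closed K" "K \<subseteq> U" "open S" "smooth_fun_on A (S \<inter> U) f"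
    "\<And>y. y \<in> U - K \<Longrightarrow> f y = 0"
  shows "smooth_fun_on A S (\<lambda>y. if y \<in> U then f y else 0)"
proof (rule smooth_fun_on_local)
  fix x assume "x \<in> S"
  let ?f = "\<lambda>y. if y \<in> U then f y else 0"
  show "\<exists>T. open T \<and> x \<in> T \<and> smooth_fun_on A (S \<inter> T) ?f"
  proof (cases "x \<in> U")
    case True
    have "smooth_fun_on A (S \<inter> U) ?f"
      by (rule smooth_fun_on_cong[OF _ assms(5)]) (use assms(1,4) in auto)
    then show ?thesis using True assms(1) by blast
  next
    case False
    have K: "open (S \<inter> - K)" using assms(2,4) by auto
    have "smooth_fun_on A (S \<inter> - K) ?f"
      by (rule smooth_fun_on_cong[OF K smooth_fun_on_const[OF K, of 0]]) (use assms(6) in auto)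
    then show ?thesis using False assms(2,3) by blast
  qed
qed

text \<open>The coordinate bump is supported in a closed ball inside the chart. Its preimage \<open>K\<close> is compact, hence
  closed in the Hausdorff space \<open>'m\<close>, which is what extension by zero requires.\<close>

lemma chart_bump:
  assumes c: "(U, \<phi>) \<in> A" and p: "p \<in> U" "p \<in> S" "open S"
  obtains \<rho> W K where "smooth_fun_on A UNIV \<rho>" "open W" "compact K" "p \<in> W" "W \<subseteq> K" "K \<subseteq> U \<inter> S"
    "\<And>y. \<rho> y \<noteq> 0 \<longleftrightarrow> y \<in> W"
proof -
  note U = chart_open[OF c]
  have "open (\<phi> ` (U \<inter> S))" "\<phi> p \<in> \<phi> ` (U \<inter> S)"
    using chart_image_open[OF c p(3)] p by auto
  then obtain r where r: "0 < r" "cball (\<phi> p) r \<subseteq> \<phi> ` (U \<inter> S)"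
    using open_contains_cball by metis
  obtain \<beta> :: "'e \<Rightarrow> real" where \<beta>: "smooth_on \<beta> UNIV" "\<And>z. \<beta> z \<noteq> 0 \<longleftrightarrow> z \<in> ball (\<phi> p) r"
    using exists_bump[OF r(1)] by blast
  define W where "W = U \<inter> \<phi> -` ball (\<phi> p) r"
  define K where "K = inv_into U \<phi> ` cball (\<phi> p) r"
  have W: "open W"
    unfolding W_def by (rule continuous_open_preimage[OF chart_continuous[OF c] U open_ball])
  have "continuous_on (\<phi> ` U) (inv_into U \<phi>)"
    using chart_homeomorphism[OF c] by (simp add: homeomorphism_def)
  then have K: "compact K"
    unfolding K_def by (rule compact_continuous_image[OF continuous_on_subset compact_cball]) (use r in auto)
  have "K \<subseteq> U \<inter> S"
    using r(2) c by (force simp: K_def)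
  have "W \<subseteq> K"
  proof
    fix y assume "y \<in> W"
    then have "\<phi> y \<in> cball (\<phi> p) r" "y = inv_into U \<phi> (\<phi> y)"
      using c by (auto simp: W_def)
    then show "y \<in> K" unfolding K_def by (rule rev_image_eqI)
  qed
  define \<rho> where "\<rho> y = (if y \<in> U then \<beta> (\<phi> y) else 0)" for y
  have \<rho>: "\<rho> y \<noteq> 0 \<longleftrightarrow> y \<in> W" for y
    by (simp add: \<rho>_def \<beta>(2) W_def)
  have "smooth_fun_on A UNIV \<rho>"
    unfolding \<rho>_def
  proof (rule smooth_fun_on_extend_by_zero[OF U compact_imp_closed[OF K]])
    show "smooth_fun_on A (UNIV \<inter> U) (\<lambda>y. \<beta> (\<phi> y))"
      using smooth_fun_on_chart[OF c U order_refl] smooth_on_subset[OF \<beta>(1)] by simp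
    show "\<beta> (\<phi> y) = 0" if "y \<in> U - K" for y
      using that \<rho>[of y] \<open>W \<subseteq> K\<close> by (auto simp: \<rho>_def)
  qed (use \<open>K \<subseteq> U \<inter> S\<close> in auto)
  then show thesis
    using W K \<open>W \<subseteq> K\<close> \<open>K \<subseteq> U \<inter> S\<close> \<rho> p r(1) by (intro that[of \<rho> W K]) (auto simp: W_def)
qed

lemma vector_field_local:
  assumes "\<And>x. \<exists>S Y. open S \<and> x \<in> S \<and> Y \<in> vector_fields A \<and> (\<forall>y\<in>S. Z y = Y y)"
  shows "Z \<in> vector_fields A"
proof (rule vector_fieldsI)
  show "Z x \<in> tangent_space A x" for x
    using assms[of x] vector_field_tangent by fastforce
  fix U \<phi> and b :: 'e assume c: "(U, \<phi>) \<in> A" and b: "b \<in> Basis"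
  show "smooth_fun_on A U (\<lambda>x. Z x (\<lambda>y. \<phi> y \<bullet> b))"
  proof (rule smooth_fun_on_local)
    fix x
    obtain S Y where S: "open S" "x \<in> S" and Y: "Y \<in> vector_fields A" "\<forall>y\<in>S. Z y = Y y"
      using assms by metis
    have "open (U \<inter> S)" using chart_open[OF c] S(1) by (rule open_Int)
    then have "smooth_fun_on A (U \<inter> S) (\<lambda>x. Z x (\<lambda>y. \<phi> y \<bullet> b))"
      by (rule smooth_fun_on_cong[OF _ smooth_fun_on_subset[OF vector_field_component[OF Y(1) c b]]])
        (use Y(2) in auto)
    then show "\<exists>T. open T \<and> x \<in> T \<and> smooth_fun_on A (U \<inter> T) (\<lambda>x. Z x (\<lambda>y. \<phi> y \<bullet> b))"
      using S by blast
  qed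
qed

text \<open>Coordinate vector fields exist only on a chart, and a general vector field has coefficients only there. One
  factor of a bump \<open>\<beta>\<close> globalizes the fields \<open>E b\<close> and another one the coefficients \<open>h b\<close>, whence \<open>\<rho> = \<beta>\<^sup>2\<close>.\<close>

lemma local_frame:
  obtains \<rho> :: "'m \<Rightarrow> real" and E :: "'e \<Rightarrow> 'm vfield"
  where "\<exists>W. open W \<and> p \<in> W \<and> (\<forall>x\<in>W. \<rho> x \<noteq> 0)" "smooth_fun_on A UNIV \<rho>"
    "\<And>b. E b \<in> vector_fields A"
    "\<And>X. X \<in> vector_fields A \<Longrightarrow> \<exists>h. (\<forall>b\<in>Basis. smooth_fun_on A UNIV (h b)) \<and>
      (\<lambda>x. \<rho> x *\<^sub>R X x) = (\<Sum>b\<in>Basis. (\<lambda>x. h b x *\<^sub>R E b x))"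
proof -
  obtain U \<phi> where c: "(U, \<phi>) \<in> A" "p \<in> U" using chart_exists by blast
  note U = chart_open[OF c(1)]
  obtain \<beta> W K where \<beta>: "smooth_fun_on A UNIV \<beta>" "\<And>y. \<beta> y \<noteq> 0 \<longleftrightarrow> y \<in> W"
    and W: "open W" "p \<in> W" "W \<subseteq> K" and K: "compact K" "K \<subseteq> U \<inter> UNIV"
    by (rule chart_bump[OF c UNIV_I open_UNIV]) (rule that)
  note ext = smooth_fun_on_extend_by_zero[OF U compact_imp_closed[OF K(1)]]
  have K': "K \<subseteq> U" using K(2) by simp
  have \<beta>0: "\<beta> y = 0" if "y \<notin> K" for y using \<beta>(2)[of y] W(3) that by blast
  define E where "E b y = (if y \<in> U then \<beta> y *\<^sub>R coord_vector A (U, \<phi>) b y else 0)" for b y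
  have E: "E b \<in> vector_fields A" for b
  proof (rule vector_fieldsI)
    show "E b x \<in> tangent_space A x" for x
      using subspace_scale[OF subspace_tangent_space coord_vector_tangent[OF c(1)]]
        subspace_0[OF subspace_tangent_space] by (simp add: E_def)
    fix V \<psi> and b' :: 'e assume d: "(V, \<psi>) \<in> A"
    note V = chart_open[OF d]
    let ?g = "\<lambda>y. \<beta> y * frechet_derivative ((\<lambda>y. \<psi> y \<bullet> b') \<circ> inv_into U \<phi>) (at (\<phi> y)) b"
    have "smooth_fun_on A (U \<inter> V) ?g"
      by (rule smooth_fun_on_mult[OF open_Int[OF U V] smooth_fun_on_subset[OF \<beta>(1)]
            smooth_fun_on_partial_derivative[OF c(1) V smooth_fun_on_coordinate[OF d]]]) simp
    then have "smooth_fun_on A (V \<inter> U) ?g" by (simp only: Int_commute)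
    then have "smooth_fun_on A V (\<lambda>y. if y \<in> U then ?g y else 0)"
      by (rule ext[OF K' V]) (use \<beta>0 in auto)
    then show "smooth_fun_on A V (\<lambda>x. E b x (\<lambda>y. \<psi> y \<bullet> b'))"
    proof (rule smooth_fun_on_cong[OF V])
      fix x assume "x \<in> V"
      then show "(if x \<in> U then ?g x else 0) = E b x (\<lambda>y. \<psi> y \<bullet> b')"
        using smooth_near_coordinate[OF d, of x b'] by (simp add: E_def coord_vector_def)
    qed
  qed
  have "\<exists>h. (\<forall>b\<in>Basis. smooth_fun_on A UNIV (h b)) \<and>
      (\<lambda>x. (\<beta> x * \<beta> x) *\<^sub>R X x) = (\<Sum>b\<in>Basis. (\<lambda>x. h b x *\<^sub>R E b x))"
    if X: "X \<in> vector_fields A" for X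
  proof (intro exI conjI ballI)
    let ?h = "\<lambda>b y. if y \<in> U then \<beta> y * X y (\<lambda>y. \<phi> y \<bullet> b) else 0"
    show "smooth_fun_on A UNIV (?h b)" if b: "b \<in> Basis" for b
    proof (rule ext[OF K' open_UNIV])
      show "smooth_fun_on A (UNIV \<inter> U) (\<lambda>y. \<beta> y * X y (\<lambda>y. \<phi> y \<bullet> b))"
        using smooth_fun_on_mult[OF U smooth_fun_on_subset[OF \<beta>(1)] vector_field_component[OF X c(1) b]]
        by simp
    qed (use \<beta>0 in auto)
    show "(\<lambda>x. (\<beta> x * \<beta> x) *\<^sub>R X x) = (\<Sum>b\<in>Basis. (\<lambda>x. ?h b x *\<^sub>R E b x))"
    proof
      fix x
      show "(\<beta> x * \<beta> x) *\<^sub>R X x = (\<Sum>b\<in>Basis. (\<lambda>x. ?h b x *\<^sub>R E b x)) x"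
      proof (cases "x \<in> U")
        case True
        have "(\<beta> x * \<beta> x) *\<^sub>R X x =
            (\<beta> x * \<beta> x) *\<^sub>R (\<Sum>b\<in>Basis. X x (\<lambda>y. \<phi> y \<bullet> b) *\<^sub>R coord_vector A (U, \<phi>) b x)"
          by (rule arg_cong[OF tangent_basis[OF vector_field_tangent[OF X] c(1) True]])
        also have "\<dots> = (\<Sum>b\<in>Basis. ?h b x *\<^sub>R E b x)"
          unfolding scaleR_sum_right using True
          by (intro sum.cong refl) (simp only: E_def if_True scaleR_scaleR mult_ac)
        finally show ?thesis by (simp only: sum_fun_apply)
      next
        case False
        then have "\<beta> x = 0" using \<beta>0 K' by blast
        then show ?thesis using False by (simp only: sum_fun_apply if_False scaleR_zero_left mult_zero_left sum.neutral_const)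
      qed
    qed
  qed
  then show thesis
    using W \<beta> smooth_fun_on_mult[OF open_UNIV \<beta>(1) \<beta>(1)]
    by (intro that[of "\<lambda>x. \<beta> x * \<beta> x" E] E) auto
qed

text \<open>The sum \<open>Z = \<Sum>\<^sub>n \<rho>\<^sub>n Y\<^sub>n\<close> is locally finite, hence smooth, and disjointness of the supports gives
  \<open>\<rho>\<^sub>n Z = \<rho>\<^sub>n\<^sup>2 Y\<^sub>n\<close>. In this form the connection between \<open>Z\<close> and \<open>Y\<^sub>n\<close> is an identity of global vector fields,
  to which function-bilinear operations can be applied.\<close>

lemma glue_vector_fields:
  fixes \<rho> :: "nat \<Rightarrow> 'm \<Rightarrow> real"
  assumes Y: "\<And>n. Y n \<in> vector_fields A" and \<rho>: "\<And>n. smooth_fun_on A UNIV (\<rho> n)"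
    and S: "\<And>i. open (S i)" "\<And>x. \<exists>i. x \<in> S i"
    and vanish: "\<And>i n x. x \<in> S i \<Longrightarrow> i < n \<Longrightarrow> \<rho> n x = 0"
    and disjoint: "\<And>m n x. m \<noteq> n \<Longrightarrow> \<rho> m x = 0 \<or> \<rho> n x = 0"
  shows "\<exists>Z\<in>vector_fields A. \<forall>n x. \<rho> n x *\<^sub>R Z x = (\<rho> n x * \<rho> n x) *\<^sub>R Y n x"
proof -
  \<comment> \<open>any index \<open>i x\<close> with \<open>x \<in> S (i x)\<close> bounds the indices of the nonzero summands at \<open>x\<close>\<close>
  define i where "i x = (SOME i. x \<in> S i)" for x
  have i: "x \<in> S (i x)" for x unfolding i_def by (rule someI_ex[OF S(2)])
  define Z where "Z x = (\<Sum>n\<le>i x. \<rho> n x *\<^sub>R Y n x)" for x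
  have Z: "Z x = (\<Sum>n\<le>l. \<rho> n x *\<^sub>R Y n x)" if "x \<in> S l" for x l
  proof -
    have "(\<Sum>n\<le>k. \<rho> n x *\<^sub>R Y n x) = (\<Sum>n\<le>max k l. \<rho> n x *\<^sub>R Y n x)" if "x \<in> S k" for k l :: nat
      by (rule sum.mono_neutral_left) (use vanish[OF that] in \<open>auto simp: not_le scaleR_zero_left\<close>)
    from this[OF i, of l] this[OF that, of "i x"] show ?thesis
      unfolding Z_def by (simp only: max.commute)
  qed
  have "Z \<in> vector_fields A"
  proof (rule vector_field_local)
    fix x
    have "(\<Sum>n\<le>i x. (\<lambda>y. \<rho> n y *\<^sub>R Y n y)) \<in> vector_fields A"
      by (intro vector_fields_sum vector_fields_mult Y \<rho>)
    moreover have "\<forall>y\<in>S (i x). Z y = (\<Sum>n\<le>i x. (\<lambda>y. \<rho> n y *\<^sub>R Y n y)) y"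
      using Z by (simp only: sum_fun_apply ball_simps) blast
    ultimately show "\<exists>S Y. open S \<and> x \<in> S \<and> Y \<in> vector_fields A \<and> (\<forall>y\<in>S. Z y = Y y)"
      using S(1) i by blast
  qed
  moreover have "\<rho> n x *\<^sub>R Z x = (\<rho> n x * \<rho> n x) *\<^sub>R Y n x" for n x
  proof (cases "\<rho> n x = 0")
    case False
    then have n: "n \<le> i x" using vanish[OF i] not_le by blast
    have "Z x = (\<Sum>m\<in>{n}. \<rho> m x *\<^sub>R Y m x)"
      unfolding Z_def
    proof (rule sum.mono_neutral_right)
      show "\<forall>m\<in>{..i x} - {n}. \<rho> m x *\<^sub>R Y m x = 0"
      proof
        fix m assume "m \<in> {..i x} - {n}"
        then have "\<rho> m x = 0" using disjoint[of m n x] False by blast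
        then show "\<rho> m x *\<^sub>R Y m x = 0" by (simp only: scaleR_zero_left)
      qed
    qed (use n in auto)
    also have "\<dots> = \<rho> n x *\<^sub>R Y n x" by simp
    finally show ?thesis by (simp only: scaleR_scaleR)
  qed (simp only: scaleR_zero_left mult_zero_left)
  ultimately show ?thesis by blast
qed

text \<open>Second countability, through Lindelof's theorem, makes countably many of the relatively compact supports of
  bumps suffice.\<close>

lemma countable_compact_cover:
  obtains S K :: "nat \<Rightarrow> 'm set"
  where "\<And>i. open (S i)" "\<And>i. compact (K i)" "\<And>i. S i \<subseteq> K i" "\<And>x. \<exists>i. x \<in> S i"
proof -
  let ?F = "{S :: 'm set. open S \<and> (\<exists>K. compact K \<and> S \<subseteq> K)}"
  have nbhd: "\<exists>S\<in>?F. x \<in> S" for x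
  proof -
    obtain U \<phi> where c: "(U, \<phi>) \<in> A" "x \<in> U" using chart_exists by blast
    then obtain W K where "open W" "compact K" "x \<in> W" "W \<subseteq> K"
      by (rule chart_bump[OF _ _ UNIV_I open_UNIV]) (rule that)
    then show ?thesis by blast
  qed
  obtain F where F: "F \<subseteq> ?F" "countable F" "\<Union>F = \<Union>?F"
    using Lindelof[of ?F] by auto
  have "\<Union>F = UNIV" using nbhd F(3) by blast
  then have ne: "F \<noteq> {}" by auto
  define S where "S = from_nat_into F"
  have S: "S i \<in> F" for i
    unfolding S_def by (rule from_nat_into[OF ne])
  then have "\<exists>K. compact K \<and> S i \<subseteq> K" for i using F(1) by blast
  then obtain K where K: "\<And>i. compact (K i) \<and> S i \<subseteq> K i" by metis
  have cover: "\<exists>i. x \<in> S i" for x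
  proof -
    have "x \<in> \<Union>F" unfolding \<open>\<Union>F = UNIV\<close> by (rule UNIV_I)
    then obtain T where "T \<in> F" "x \<in> T" by (rule UnionE)
    then show ?thesis
      using from_nat_into_surj[OF F(2)] unfolding S_def by blast
  qed
  have "open (S i)" for i using S[of i] F(1) by blast
  then show thesis
    by (rule that[of S K]) (use K cover in blast)+
qed

text \<open>If the sequence \<open>x\<close> has no cluster point, it leaves every compact set. One picks recursively a later point outside
  the compact set \<open>C\<close> formed by all the supports chosen before and by the first members of a compact cover, and a
  bump around that point supported off \<open>C\<close>. Avoiding the supports makes them disjoint, avoiding the cover makes
  them locally finite.\<close>

lemma escaping_bumps:
  fixes x :: "nat \<Rightarrow> 'm"
  assumes esc: "\<And>p. \<exists>S. open S \<and> p \<in> S \<and> finite {k. x k \<in> S}"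
  obtains k :: "nat \<Rightarrow> nat" and \<rho> :: "nat \<Rightarrow> 'm \<Rightarrow> real" and S :: "nat \<Rightarrow> 'm set"
  where "strict_mono k" "\<And>n. smooth_fun_on A UNIV (\<rho> n)" "\<And>n. \<rho> n (x (k n)) \<noteq> 0"
    "\<And>m n y. m \<noteq> n \<Longrightarrow> \<rho> m y = 0 \<or> \<rho> n y = 0"
    "\<And>i. open (S i)" "\<And>y. \<exists>i. y \<in> S i" "\<And>i n y. y \<in> S i \<Longrightarrow> i < n \<Longrightarrow> \<rho> n y = 0"
proof -
  obtain S L :: "nat \<Rightarrow> 'm set" where S: "\<And>i. open (S i)" "\<And>x. \<exists>i. x \<in> S i"
    and L: "\<And>i. compact (L i)" "\<And>i. S i \<subseteq> L i"
    by (rule countable_compact_cover) (rule that)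
  have fin: "finite {k. x k \<in> C}" if C: "compact C" for C
  proof -
    have cov: "C \<subseteq> \<Union>{S. open S \<and> finite {k. x k \<in> S}}"
    proof
      fix y assume "y \<in> C"
      show "y \<in> \<Union>{S. open S \<and> finite {k. x k \<in> S}}" using esc[of y] by blast
    qed
    obtain F where F: "F \<subseteq> {S. open S \<and> finite {k. x k \<in> S}}" "finite F" "C \<subseteq> \<Union>F"
      by (rule compactE[OF C cov]) (use that in auto)
    have "{k. x k \<in> C} \<subseteq> (\<Union>S\<in>F. {k. x k \<in> S})" using F(3) by blast
    moreover have "finite (\<Union>S\<in>F. {k. x k \<in> S})" using F(1,2) by (intro finite_UN_I) auto
    ultimately show ?thesis by (rule finite_subset)
  qed
  \<comment> \<open>a state is an index \<open>k\<close>, a bump \<open>\<rho>\<close> at \<open>x k\<close> with support in \<open>K\<close>, and the compact set \<open>C\<close> avoided by \<open>K\<close>\<close>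
  define P where "P = (\<lambda>(k, \<rho>, K, C). smooth_fun_on A UNIV \<rho> \<and> \<rho> (x k) \<noteq> 0 \<and> compact K \<and> compact C
    \<and> K \<inter> C = {} \<and> (\<forall>y. \<rho> y \<noteq> 0 \<longrightarrow> y \<in> K))"
  define Q where "Q n = (\<lambda>(k, \<rho> :: 'm \<Rightarrow> real, K, C) (k', \<rho>' :: 'm \<Rightarrow> real, K' :: 'm set, C'). (k::nat) < k' \<and> K \<union> C \<union> L n \<subseteq> C')" for n
  have next_bump: "\<exists>k \<rho> K. k0 < k \<and> P (k, \<rho>, K, C)" if C: "compact C" for k0 C
  proof -
    have "finite ({k. x k \<in> C} \<union> {..k0})"
      using fin[OF C] by simp
    then obtain k where "k \<notin> {k. x k \<in> C} \<union> {..k0}"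
      using ex_new_if_finite[OF infinite_UNIV_nat] by blast
    then have k: "k0 < k" "x k \<notin> C" by auto
    obtain U \<phi> where c: "(U, \<phi>) \<in> A" "x k \<in> U" using chart_exists by blast
    have "x k \<in> - C" "open (- C)"
      using k compact_imp_closed[OF C] by auto
    then obtain \<rho> W K where "smooth_fun_on A UNIV \<rho>" "open W" "compact K" "x k \<in> W" "W \<subseteq> K" "K \<subseteq> U \<inter> - C"
        "\<And>y. \<rho> y \<noteq> 0 \<longleftrightarrow> y \<in> W"
      by (rule chart_bump[OF c]) (rule that)
    then show ?thesis
      using k C by (intro exI[of _ k] exI[of _ \<rho>] exI[of _ K]) (auto simp: P_def)
  qed
  have "\<exists>f. \<forall>n. P (f n) \<and> Q n (f n) (f (Suc n))"
  proof (rule dependent_nat_choice[of "\<lambda>_. P" Q])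
    show "\<exists>s. P s" using next_bump[OF compact_empty] by metis
    fix s n assume s: "P s"
    obtain k \<rho> K C where s_eq: "s = (k, \<rho>, K, C)" by (cases s)
    have "compact (K \<union> C \<union> L n)"
      using s L(1) by (auto simp: P_def s_eq)
    from next_bump[OF this, of k] show "\<exists>t. P t \<and> Q n s t"
      unfolding s_eq Q_def by fastforce
  qed
  then obtain f where f: "\<And>n. P (f n)" "\<And>n. Q n (f n) (f (Suc n))" by blast
  define k \<rho> K C where "k n = fst (f n)" and "\<rho> n = fst (snd (f n))" and "K n = fst (snd (snd (f n)))"
    and "C n = snd (snd (snd (f n)))" for n
  have f_eq: "f n = (k n, \<rho> n, K n, C n)" for n by (simp add: k_def \<rho>_def K_def C_def)
  have P: "smooth_fun_on A UNIV (\<rho> n)" "\<rho> n (x (k n)) \<noteq> 0" "K n \<inter> C n = {}" "\<rho> n y \<noteq> 0 \<Longrightarrow> y \<in> K n" for n y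
    using f(1)[of n] unfolding f_eq P_def by auto
  have Q: "k n < k (Suc n)" "K n \<subseteq> C (Suc n)" "C n \<subseteq> C (Suc n)" "L n \<subseteq> C (Suc n)" for n
    using f(2)[of n] unfolding f_eq Q_def by auto
  have C_mono: "C m \<subseteq> C n" if "m \<le> n" for m n
    by (rule lift_Suc_mono_le[of C, OF Q(3) that])
  have KL: "K m \<subseteq> C n" "L m \<subseteq> C n" if "m < n" for m n
    using Q(2,4)[of m] C_mono[of "Suc m" n] that by auto
  have disj: "\<rho> m y = 0 \<or> \<rho> n y = 0" if "m < n" for m n y
    using P(3)[of n] P(4)[of m y] P(4)[of n y] KL(1)[OF that] by blast
  show thesis
  proof (rule that[of k \<rho> S])
    show "strict_mono k" using Q(1) by (simp add: strict_mono_Suc_iff)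
    show "\<rho> m y = 0 \<or> \<rho> n y = 0" if "m \<noteq> n" for m n y
      using disj[of m n y] disj[of n m y] that by (metis linorder_neqE_nat)
    show "\<rho> n y = 0" if "y \<in> S i" "i < n" for i n y
      using that L(2)[of i] KL(2)[of i n] P(3)[of n] P(4)[of n y] by blast
  qed (fact P S)+
qed

end

section \<open>Almost complex structures\<close>

locale almost_complex_manifold = smooth_manifold A
  for A :: "('m::{t2_space, second_countable_topology}, 'e::euclidean_space) chart set" +
  fixes J :: "'m endo_field"
  assumes acs: "almost_complex_structure A J"
begin

abbreviation j where "j \<equiv> endo_app J"

lemma J_tangent: "v \<in> tangent_space A x \<Longrightarrow> J x v \<in> tangent_space A x"
  and J_J: "v \<in> tangent_space A x \<Longrightarrow> J x (J x v) = - v"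
  and J_add: "v \<in> tangent_space A x \<Longrightarrow> w \<in> tangent_space A x \<Longrightarrow> J x (v + w) = J x v + J x w"
  and J_scaleR: "v \<in> tangent_space A x \<Longrightarrow> J x (c *\<^sub>R v) = c *\<^sub>R J x v"
  using acs by (auto simp: almost_complex_structure_def)

lemma J_zero: "J x 0 = 0"
  using J_scaleR[OF subspace_0[OF subspace_tangent_space], of x 0] by (simp only: scaleR_zero_left)

lemma J_sum:
  assumes "\<And>i. i \<in> I \<Longrightarrow> v i \<in> tangent_space A x"
  shows "J x (\<Sum>i\<in>I. v i) = (\<Sum>i\<in>I. J x (v i))"
  using assms
proof (induction I rule: infinite_finite_induct)
  case (insert i I)
  have "J x (v i + sum v I) = J x (v i) + J x (sum v I)"
    using insert.prems by (intro J_add subspace_sum[OF subspace_tangent_space]) auto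
  moreover have "J x (sum v I) = (\<Sum>i\<in>I. J x (v i))"
    by (rule insert.IH) (use insert.prems in auto)
  ultimately show ?case
    unfolding sum.insert[OF insert.hyps] by (simp only:)
qed (simp_all only: sum.infinite sum.empty J_zero not_False_eq_True)

text \<open>In a chart the components of \<open>j X\<close> are the matrix of \<open>J\<close> applied to the components of \<open>X\<close>.\<close>

lemma j_vector_field:
  assumes X: "X \<in> vector_fields A"
  shows "j X \<in> vector_fields A"
proof (rule vector_fieldsI)
  show "j X x \<in> tangent_space A x" for x
    by (simp add: endo_app_def J_tangent vector_field_tangent[OF X])
  fix U \<phi> and b :: 'e assume c: "(U, \<phi>) \<in> A" and b: "b \<in> Basis"
  note U = chart_open[OF c]
  have "smooth_fun_on A U (\<lambda>x. J x (coord_vector A (U, \<phi>) b' x) (\<lambda>y. \<phi> y \<bullet> b))" if "b' \<in> Basis" for b'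
    using acs c b that by (fastforce simp: almost_complex_structure_def)
  then have "smooth_fun_on A U (\<lambda>x. \<Sum>b'\<in>Basis. X x (\<lambda>y. \<phi> y \<bullet> b') * J x (coord_vector A (U, \<phi>) b' x) (\<lambda>y. \<phi> y \<bullet> b))"
    by (intro smooth_fun_on_sum smooth_fun_on_mult U vector_field_component[OF X c])
  then show "smooth_fun_on A U (\<lambda>x. j X x (\<lambda>y. \<phi> y \<bullet> b))"
  proof (rule smooth_fun_on_cong[OF U])
    fix x assume x: "x \<in> U"
    note e = coord_vector_tangent[OF c x]
    define X' where "X' b = X x (\<lambda>y. \<phi> y \<bullet> b)" for b
    have "X x = (\<Sum>b\<in>Basis. X' b *\<^sub>R coord_vector A (U, \<phi>) b x)"
      unfolding X'_def by (rule tangent_basis[OF vector_field_tangent[OF X] c x])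
    then have "J x (X x) = J x (\<Sum>b\<in>Basis. X' b *\<^sub>R coord_vector A (U, \<phi>) b x)"
      by (rule arg_cong)
    also have "\<dots> = (\<Sum>b\<in>Basis. J x (X' b *\<^sub>R coord_vector A (U, \<phi>) b x))"
      by (rule J_sum) (rule subspace_scale[OF subspace_tangent_space e])
    also have "\<dots> = (\<Sum>b\<in>Basis. X' b *\<^sub>R J x (coord_vector A (U, \<phi>) b x))"
      by (rule sum.cong[OF refl J_scaleR[OF e]])
    finally have "J x (X x) (\<lambda>y. \<phi> y \<bullet> b) =
        (\<Sum>b'\<in>Basis. X' b' * J x (coord_vector A (U, \<phi>) b' x) (\<lambda>y. \<phi> y \<bullet> b))"
      by (simp only: sum_fun_apply scaleR_fun_apply real_scaleR_def)
    then show "(\<Sum>b'\<in>Basis. X x (\<lambda>y. \<phi> y \<bullet> b') * J x (coord_vector A (U, \<phi>) b' x) (\<lambda>y. \<phi> y \<bullet> b)) = j X x (\<lambda>y. \<phi> y \<bullet> b)"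
      unfolding X'_def endo_app_def by (rule sym)
  qed
qed

lemma j_j: "X \<in> vector_fields A \<Longrightarrow> j (j X) = - X"
  by (intro ext) (simp add: endo_app_def J_J[OF vector_field_tangent])

lemma j_add: "X \<in> vector_fields A \<Longrightarrow> Y \<in> vector_fields A \<Longrightarrow> j (X + Y) = j X + j Y"
  by (intro ext) (simp add: endo_app_def J_add[OF vector_field_tangent vector_field_tangent])

lemma j_mult: "X \<in> vector_fields A \<Longrightarrow> j (\<lambda>x. f x *\<^sub>R X x) = (\<lambda>x. f x *\<^sub>R j X x)"
  by (intro ext) (simp add: endo_app_def J_scaleR[OF vector_field_tangent])

lemma j_scaleR: "X \<in> vector_fields A \<Longrightarrow> j (c *\<^sub>R X) = c *\<^sub>R j X"
  by (intro ext) (simp add: endo_app_def J_scaleR[OF vector_field_tangent])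

lemma j_minus: "X \<in> vector_fields A \<Longrightarrow> j (- X) = - j X"
  using j_scaleR[of X "-1"] by simp

lemma j_diff: "X \<in> vector_fields A \<Longrightarrow> Y \<in> vector_fields A \<Longrightarrow> j (X - Y) = j X - j Y"
  using j_add[of X "- Y"] by (simp add: vector_fields_neg j_minus)

section \<open>Tensoriality of the Nijenhuis tensor\<close>

lemma nijenhuis_antisym:
  "X \<in> vector_fields A \<Longrightarrow> Y \<in> vector_fields A \<Longrightarrow> nijenhuis A J Y X = - nijenhuis A J X Y"
  by (simp add: nijenhuis_def lie_bracket_antisym[of Y X] lie_bracket_antisym[of "j Y"]
      lie_bracket_antisym[of Y "j X"] j_minus lie_bracket_vector_field j_vector_field)

lemma nijenhuis_add_left:
  assumes "X \<in> vector_fields A" "Y \<in> vector_fields A" "Z \<in> vector_fields A"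
  shows "nijenhuis A J (X + Y) Z = nijenhuis A J X Z + nijenhuis A J Y Z"
  using assms unfolding nijenhuis_def
  by (simp add: j_add lie_bracket_add_left j_vector_field lie_bracket_vector_field)

text \<open>The two terms \<open>(Y h) X\<close> and the two terms \<open>((j Y) h) (j X)\<close> cancel, the former because of \<open>j\<^sup>2 = -1\<close>.\<close>

lemma nijenhuis_mult_left:
  assumes X: "X \<in> vector_fields A" and Y: "Y \<in> vector_fields A" and h: "smooth_fun_on A UNIV h"
  shows "nijenhuis A J (\<lambda>x. h x *\<^sub>R X x) Y = (\<lambda>x. h x *\<^sub>R nijenhuis A J X Y x)"
proof -
  note [simp] = X Y j_vector_field lie_bracket_vector_field vector_fields_mult h
  have [simp]: "smooth_fun_on A UNIV (\<lambda>x. Y x h)" "smooth_fun_on A UNIV (\<lambda>x. j Y x h)"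
    by (auto intro: smooth_fun_on_vector_field)
  show ?thesis
    unfolding nijenhuis_def
    by (simp add: lie_bracket_mult_left j_mult j_diff j_j) (simp add: fun_eq_iff algebra_simps)
qed

lemma nijenhuis_sum_left:
  assumes "\<And>i. i \<in> I \<Longrightarrow> X i \<in> vector_fields A" "Y \<in> vector_fields A"
  shows "nijenhuis A J (\<Sum>i\<in>I. X i) Y = (\<Sum>i\<in>I. nijenhuis A J (X i) Y)"
  using assms(1)
proof (induction I rule: infinite_finite_induct)
  case (insert i I)
  have "nijenhuis A J (X i + sum X I) Y = nijenhuis A J (X i) Y + nijenhuis A J (sum X I) Y"
    by (intro nijenhuis_add_left vector_fields_sum assms(2)) (use insert.prems in auto)
  moreover have "nijenhuis A J (sum X I) Y = (\<Sum>i\<in>I. nijenhuis A J (X i) Y)"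
    by (rule insert.IH) (use insert.prems in auto)
  ultimately show ?case
    unfolding sum.insert[OF insert.hyps] by (simp only:)
qed (use nijenhuis_mult_left[OF subspace_0[OF subspace_vector_fields] assms(2)
      smooth_fun_on_const[OF open_UNIV, of 0]] in \<open>auto simp: zero_fun_def\<close>)

text \<open>Antisymmetry transfers linearity over functions to the second argument.\<close>

lemma nijenhuis_bilinear:
  assumes X: "X \<in> vector_fields A" and Y: "Y \<in> vector_fields A" and h: "smooth_fun_on A UNIV h"
    and k: "smooth_fun_on A UNIV k"
  shows "nijenhuis A J (\<lambda>x. h x *\<^sub>R X x) (\<lambda>x. k x *\<^sub>R Y x) x = (h x * k x) *\<^sub>R nijenhuis A J X Y x"
proof -
  have kY: "(\<lambda>x. k x *\<^sub>R Y x) \<in> vector_fields A"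
    by (rule vector_fields_mult[OF Y k])
  have "nijenhuis A J X (\<lambda>x. k x *\<^sub>R Y x) x = - nijenhuis A J (\<lambda>x. k x *\<^sub>R Y x) X x"
    using nijenhuis_antisym[OF kY X] by (simp only: uminus_apply)
  also have "\<dots> = k x *\<^sub>R nijenhuis A J X Y x"
    unfolding nijenhuis_mult_left[OF Y X k] using nijenhuis_antisym[OF X Y]
    by (simp only: uminus_apply scaleR_minus_right minus_minus)
  finally show ?thesis
    unfolding nijenhuis_mult_left[OF X kY h] by (simp only: scaleR_scaleR)
qed

lemma nijenhuis_sum_right:
  assumes "\<And>i. i \<in> I \<Longrightarrow> X i \<in> vector_fields A" "Y \<in> vector_fields A"
  shows "nijenhuis A J Y (\<Sum>i\<in>I. X i) = (\<Sum>i\<in>I. nijenhuis A J Y (X i))"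
proof -
  have "(\<Sum>i\<in>I. X i) \<in> vector_fields A"
    by (rule vector_fields_sum) (rule assms(1))
  then have "nijenhuis A J Y (\<Sum>i\<in>I. X i) = - nijenhuis A J (\<Sum>i\<in>I. X i) Y"
    by (rule nijenhuis_antisym[OF _ assms(2)])
  also have "nijenhuis A J (\<Sum>i\<in>I. X i) Y = (\<Sum>i\<in>I. nijenhuis A J (X i) Y)"
    by (rule nijenhuis_sum_left) (use assms in auto)
  also have "- \<dots> = (\<Sum>i\<in>I. nijenhuis A J Y (X i))"
    unfolding sum_negf[symmetric]
    by (rule sum.cong[OF refl]) (rule nijenhuis_antisym[symmetric], use assms in auto)
  finally show ?thesis .
qed

section \<open>A uniform bound for the image of the Nijenhuis tensor\<close>

text \<open>After multiplication with a function \<open>\<rho>\<close> that does not vanish near \<open>p\<close>, vector fields are combinations of the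
  frame fields, and \<open>\<rho>(x)\<^sup>2\<close> can be divided out pointwise.\<close>

lemma nijenhuis_locally_finitely_generated:
  "\<exists>W G. open W \<and> p \<in> W \<and> finite G \<and> G \<subseteq> vector_fields A \<and>
    (\<forall>x\<in>W. \<forall>X\<in>vector_fields A. \<forall>Y\<in>vector_fields A.
      nijenhuis A J X Y x \<in> span ((\<lambda>(E, F). nijenhuis A J E F x) ` (G \<times> G)))"
proof -
  obtain \<rho> :: "'m \<Rightarrow> real" and E :: "'e \<Rightarrow> 'm vfield"
    where W: "\<exists>W. open W \<and> p \<in> W \<and> (\<forall>x\<in>W. \<rho> x \<noteq> 0)" and \<rho>: "smooth_fun_on A UNIV \<rho>"
    and E: "\<And>b. E b \<in> vector_fields A"
    and frame: "\<And>X. X \<in> vector_fields A \<Longrightarrow> \<exists>h. (\<forall>b\<in>Basis. smooth_fun_on A UNIV (h b)) \<and>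
      (\<lambda>x. \<rho> x *\<^sub>R X x) = (\<Sum>b\<in>Basis. (\<lambda>x. h b x *\<^sub>R E b x))"
    by (rule local_frame) (rule that)
  let ?N = "\<lambda>x. (\<lambda>(E, F). nijenhuis A J E F x) ` (E ` Basis \<times> E ` Basis)"
  have "nijenhuis A J X Y x \<in> span (?N x)"
    if "\<rho> x \<noteq> 0" and X: "X \<in> vector_fields A" and Y: "Y \<in> vector_fields A" for X Y x
  proof -
    obtain h where h: "\<And>b. b \<in> Basis \<Longrightarrow> smooth_fun_on A UNIV (h b)"
        "(\<lambda>x. \<rho> x *\<^sub>R X x) = (\<Sum>b\<in>Basis. (\<lambda>x. h b x *\<^sub>R E b x))"
      using frame[OF X] by blast
    obtain k where k: "\<And>b. b \<in> Basis \<Longrightarrow> smooth_fun_on A UNIV (k b)"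
        "(\<lambda>x. \<rho> x *\<^sub>R Y x) = (\<Sum>b\<in>Basis. (\<lambda>x. k b x *\<^sub>R E b x))"
      using frame[OF Y] by blast
    have hE: "(\<lambda>x. h b x *\<^sub>R E b x) \<in> vector_fields A" if "b \<in> Basis" for b
      by (rule vector_fields_mult[OF E h(1)[OF that]])
    have kE: "(\<lambda>x. k b x *\<^sub>R E b x) \<in> vector_fields A" if "b \<in> Basis" for b
      by (rule vector_fields_mult[OF E k(1)[OF that]])
    have "(\<rho> x * \<rho> x) *\<^sub>R nijenhuis A J X Y x =
        nijenhuis A J (\<Sum>b\<in>Basis. (\<lambda>x. h b x *\<^sub>R E b x)) (\<Sum>b\<in>Basis. (\<lambda>x. k b x *\<^sub>R E b x)) x"
      unfolding h(2)[symmetric] k(2)[symmetric] by (rule nijenhuis_bilinear[OF X Y \<rho> \<rho>, symmetric])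
    also have "nijenhuis A J (\<Sum>b\<in>Basis. (\<lambda>x. h b x *\<^sub>R E b x)) (\<Sum>b\<in>Basis. (\<lambda>x. k b x *\<^sub>R E b x)) =
        (\<Sum>b\<in>Basis. nijenhuis A J (\<lambda>x. h b x *\<^sub>R E b x) (\<Sum>b\<in>Basis. (\<lambda>x. k b x *\<^sub>R E b x)))"
      by (rule nijenhuis_sum_left[OF hE vector_fields_sum[OF kE]])
    also have "\<dots> = (\<Sum>b\<in>Basis. \<Sum>c\<in>Basis. nijenhuis A J (\<lambda>x. h b x *\<^sub>R E b x) (\<lambda>x. k c x *\<^sub>R E c x))"
      by (intro sum.cong refl nijenhuis_sum_right kE hE)
    also have "\<dots> x = (\<Sum>b\<in>Basis. \<Sum>c\<in>Basis. nijenhuis A J (\<lambda>x. h b x *\<^sub>R E b x) (\<lambda>x. k c x *\<^sub>R E c x) x)"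
      by (simp only: sum_fun_apply[where x = x])
    also have "\<dots> = (\<Sum>b\<in>Basis. \<Sum>c\<in>Basis. (h b x * k c x) *\<^sub>R nijenhuis A J (E b) (E c) x)"
      by (intro sum.cong refl nijenhuis_bilinear E h k)
    also have "\<dots> \<in> span (?N x)"
      by (intro span_sum span_scale span_base) auto
    finally have "(\<rho> x * \<rho> x) *\<^sub>R nijenhuis A J X Y x \<in> span (?N x)" .
    then have "inverse (\<rho> x * \<rho> x) *\<^sub>R (\<rho> x * \<rho> x) *\<^sub>R nijenhuis A J X Y x \<in> span (?N x)"
      by (rule span_scale)
    moreover have "inverse (\<rho> x * \<rho> x) * (\<rho> x * \<rho> x) = 1"
      by (rule left_inverse) (use that(1) in simp)
    ultimately show ?thesis by (simp only: scaleR_scaleR scaleR_one)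
  qed
  moreover have "finite (E ` Basis)" "E ` Basis \<subseteq> vector_fields A"
    using E by auto
  ultimately show ?thesis using W by metis
qed

text \<open>In an involutive limit each value \<open>N(X, Y)\<close> lies in some level \<open>\<Delta> k\<close>, but a priori \<open>k\<close> depends on \<open>X\<close> and \<open>Y\<close>, while
  a section of the image distribution mixes the values of infinitely many pairs. A single level suffices: otherwise
  there are points \<open>x\<^sub>k\<close> with \<open>N(X\<^sub>k, Y\<^sub>k)(x\<^sub>k) \<notin> \<Delta> k x\<^sub>k\<close>. They cannot cluster at a point \<open>p\<close>, because near \<open>p\<close> the
  image is generated by finitely many pairs of global fields, whose values all lie in one level. If they do not
  cluster, infinitely many of the \<open>X\<^sub>k\<close> and \<open>Y\<^sub>k\<close> can be glued to fields \<open>U\<close> and \<open>V\<close>. Then \<open>N(U, V)\<close> lies in some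
  level \<open>m\<close>, although at the chosen points it is a nonzero multiple of \<open>N(X\<^sub>k, Y\<^sub>k)\<close> and \<open>k\<close> becomes larger than \<open>m\<close>.\<close>

lemma nijenhuis_image_in_single_level:
  fixes \<Delta> :: "nat \<Rightarrow> 'm \<Rightarrow> 'm tvec set"
  assumes sub: "\<And>k x. subspace (\<Delta> k x)" and mono: "mono (\<lambda>k. sections A (\<Delta> k))"
    and N: "\<And>X Y. X \<in> vector_fields A \<Longrightarrow> Y \<in> vector_fields A
      \<Longrightarrow> nijenhuis A J X Y \<in> (\<Union>k. sections A (\<Delta> k))"
  shows "\<exists>k. \<forall>x. nijenhuis_image A J x \<subseteq> \<Delta> k x"
proof (rule ccontr)
  assume "\<nexists>k. \<forall>x. nijenhuis_image A J x \<subseteq> \<Delta> k x"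
  then have ex: "\<exists>x. \<not> nijenhuis_image A J x \<subseteq> \<Delta> k x" for k by blast
  have "\<exists>x X Y. X \<in> vector_fields A \<and> Y \<in> vector_fields A \<and> nijenhuis A J X Y x \<notin> \<Delta> k x" for k
  proof -
    obtain x where x: "\<not> nijenhuis_image A J x \<subseteq> \<Delta> k x" using ex by blast
    have "\<not> {nijenhuis A J X Y x |X Y. X \<in> vector_fields A \<and> Y \<in> vector_fields A} \<subseteq> \<Delta> k x"
      using x span_minimal[OF _ sub[of k x]] unfolding nijenhuis_image_def by blast
    then show ?thesis by blast
  qed
  then obtain x X Y where X: "\<And>k. X k \<in> vector_fields A" and Y: "\<And>k. Y k \<in> vector_fields A"
    and XY: "\<And>k. nijenhuis A J (X k) (Y k) (x k) \<notin> \<Delta> k (x k)"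
    by metis
  have eventually_in: "\<exists>m. \<forall>k\<ge>m. \<forall>x. nijenhuis A J U V x \<in> \<Delta> k x"
    if UV: "U \<in> vector_fields A" "V \<in> vector_fields A" for U V
  proof -
    obtain m where m: "nijenhuis A J U V \<in> sections A (\<Delta> m)" using N[OF UV] by blast
    have "nijenhuis A J U V \<in> sections A (\<Delta> k)" if "m \<le> k" for k
      using monoD[OF mono that] m by blast
    then show ?thesis by (auto simp: sections_def)
  qed
  have "\<exists>S. open S \<and> p \<in> S \<and> finite {k. x k \<in> S}" for p
  proof -
    obtain W G where W: "open W" "p \<in> W" and G: "finite G" "G \<subseteq> vector_fields A"
      and gen: "\<forall>x\<in>W. \<forall>X\<in>vector_fields A. \<forall>Y\<in>vector_fields A.
      nijenhuis A J X Y x \<in> span ((\<lambda>(E, F). nijenhuis A J E F x) ` (G \<times> G))"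
      using nijenhuis_locally_finitely_generated by metis
    have "\<forall>e\<in>G \<times> G. \<exists>m. \<forall>k\<ge>m. \<forall>x. (case e of (E, F) \<Rightarrow> nijenhuis A J E F x) \<in> \<Delta> k x"
      using eventually_in G(2) by fastforce
    then obtain m where m: "\<And>e k x. e \<in> G \<times> G \<Longrightarrow> m e \<le> k \<Longrightarrow> (case e of (E, F) \<Rightarrow> nijenhuis A J E F x) \<in> \<Delta> k x"
      by metis
    have "k < Max (insert 0 (m ` (G \<times> G)))" if "x k \<in> W" for k
    proof (rule ccontr)
      assume k: "\<not> ?thesis"
      have "m e \<le> k" if "e \<in> G \<times> G" for e
      proof -
        have "m e \<le> Max (insert 0 (m ` (G \<times> G)))"
          by (rule Max_ge) (use G(1) that in auto)
        then show ?thesis using k by linarith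
      qed
      then have "span ((\<lambda>(E, F). nijenhuis A J E F (x k)) ` (G \<times> G)) \<subseteq> \<Delta> k (x k)"
        using m by (intro span_minimal sub) auto
      then show False using gen that X Y XY by blast
    qed
    then have "finite {k. x k \<in> W}"
      by (intro finite_subset[OF _ finite_lessThan]) auto
    then show ?thesis using W by blast
  qed
  then obtain k \<rho> and S :: "nat \<Rightarrow> 'm set" where k: "strict_mono k"
    and \<rho>: "\<And>n. smooth_fun_on A UNIV (\<rho> n)" "\<And>n. \<rho> n (x (k n)) \<noteq> 0"
    and glue: "\<And>m n y. m \<noteq> n \<Longrightarrow> \<rho> m y = 0 \<or> \<rho> n y = 0"
      "\<And>i. open (S i)" "\<And>y. \<exists>i. y \<in> S i" "\<And>i n y. y \<in> S i \<Longrightarrow> i < n \<Longrightarrow> \<rho> n y = 0"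
    by (rule escaping_bumps) (rule that)
  have glued: "\<exists>Z\<in>vector_fields A. \<forall>n x. \<rho> n x *\<^sub>R Z x = (\<rho> n x * \<rho> n x) *\<^sub>R F n x"
    if F: "\<And>n. F n \<in> vector_fields A" for F
    by (rule glue_vector_fields[OF F \<rho>(1) glue(2,3)]) (fact glue)+
  obtain U where U: "U \<in> vector_fields A" "\<And>n x. \<rho> n x *\<^sub>R U x = (\<rho> n x * \<rho> n x) *\<^sub>R X (k n) x"
    using glued[of "\<lambda>n. X (k n)", OF X] by blast
  obtain V where V: "V \<in> vector_fields A" "\<And>n x. \<rho> n x *\<^sub>R V x = (\<rho> n x * \<rho> n x) *\<^sub>R Y (k n) x"
    using glued[of "\<lambda>n. Y (k n)", OF Y] by blast
  obtain m where m: "\<And>k x. m \<le> k \<Longrightarrow> nijenhuis A J U V x \<in> \<Delta> k x"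
    using eventually_in[OF U(1) V(1)] by blast
  \<comment> \<open>\<open>m\<close> serves as position in the subsequence as well: \<open>m \<le> k m\<close> puts the point at or beyond level \<open>m\<close>\<close>
  define y r where "y = x (k m)" and "r = \<rho> m y * \<rho> m y"
  have r1: "inverse (r * r) * (r * r) = 1"
    by (rule left_inverse) (use \<rho>(2)[of m] in \<open>simp add: r_def y_def\<close>)
  have sm: "smooth_fun_on A UNIV (\<lambda>x. \<rho> m x * \<rho> m x)"
    by (rule smooth_fun_on_mult[OF open_UNIV \<rho>(1) \<rho>(1)])
  have "r *\<^sub>R nijenhuis A J U V y = nijenhuis A J (\<lambda>x. \<rho> m x *\<^sub>R U x) (\<lambda>x. \<rho> m x *\<^sub>R V x) y"
    unfolding r_def by (rule nijenhuis_bilinear[OF U(1) V(1) \<rho>(1) \<rho>(1), symmetric])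
  also have "\<dots> = (r * r) *\<^sub>R nijenhuis A J (X (k m)) (Y (k m)) y"
    unfolding U(2) V(2) r_def by (rule nijenhuis_bilinear[OF X Y sm sm])
  finally have "inverse (r * r) *\<^sub>R r *\<^sub>R nijenhuis A J U V y = nijenhuis A J (X (k m)) (Y (k m)) y"
    by (simp only: scaleR_scaleR r1 scaleR_one)
  moreover have "nijenhuis A J U V y \<in> \<Delta> (k m) y"
    by (rule m[OF seq_suble[OF k]])
  ultimately have "nijenhuis A J (X (k m)) (Y (k m)) y \<in> \<Delta> (k m) y"
    using subspace_scale[OF sub] by metis
  then show False using XY by (simp add: y_def)
qed

end

section \<open>Complex vector fields\<close>

lemma mk_cvf_eq_iff: "mk_cvf X Y = mk_cvf X' Y' \<longleftrightarrow> X = X' \<and> Y = Y'"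
  by (auto simp: mk_cvf_def fun_eq_iff)

lemma mk_cvf_add: "mk_cvf X Y + mk_cvf X' Y' = mk_cvf (X + X') (Y + Y')"
  by (simp add: mk_cvf_def fun_eq_iff complex_eq_iff)

lemma mk_cvf_zero: "mk_cvf 0 0 = 0"
  by (simp add: mk_cvf_def fun_eq_iff complex_eq_iff)

lemma cscale_i_mk_cvf: "cscale_vf \<i> (mk_cvf X Y) = mk_cvf (- Y) X"
  by (simp add: mk_cvf_def cscale_vf_def fun_eq_iff complex_eq_iff)

lemma Re_Im_mk_cvf: "Re_vf (mk_cvf X Y) = X" "Im_vf (mk_cvf X Y) = Y"
  by (simp_all add: mk_cvf_def Re_vf_def Im_vf_def)

lemma A_minus_eq: "A_minus J X = mk_cvf ((1/2) *\<^sub>R X) ((1/2) *\<^sub>R endo_app J X)"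
  by (simp add: A_minus_def of_real_vf_def mk_cvf_def cscale_vf_def fun_eq_iff complex_eq_iff)

lemma complexification_eq: "complexification \<D> = {mk_cvf X Y | X Y. X \<in> \<D> \<and> Y \<in> \<D>}"
proof -
  have "of_real_vf X + cscale_vf \<i> (of_real_vf Y) = mk_cvf X Y" for X Y :: "'m vfield"
    by (simp add: of_real_vf_def cscale_i_mk_cvf mk_cvf_add)
  then show ?thesis
    unfolding complexification_def set_plus_def by (fastforce simp flip: image_comp)
qed

lemma lie_bracket_complex_mk:
  "lie_bracket_complex A (mk_cvf P Q) (mk_cvf P' Q') =
    mk_cvf (lie_bracket A P P' - lie_bracket A Q Q') (lie_bracket A P Q' + lie_bracket A Q P')"
  by (simp add: lie_bracket_complex_def Re_Im_mk_cvf)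

context almost_complex_manifold
begin

lemma j_zero: "j 0 = 0"
  using j_scaleR[OF subspace_0[OF subspace_vector_fields], of 0] by (simp only: scaleR_zero_left)

lemma T10_sections_eq: "T10_sections A J = {mk_cvf X (- j X) | X. X \<in> vector_fields A}"
proof (intro set_eqI iffI)
  fix Z assume "Z \<in> T10_sections A J"
  then obtain X Y where "Z = mk_cvf X Y" "X \<in> vector_fields A" "mk_cvf (j X) (j Y) = mk_cvf (- Y) X"
    by (auto simp: T10_sections_def complexification_eq endo_app_complex_def Re_Im_mk_cvf cscale_i_mk_cvf)
  then show "Z \<in> {mk_cvf X (- j X) | X. X \<in> vector_fields A}"
    by (auto simp: mk_cvf_eq_iff)
next
  fix Z assume "Z \<in> {mk_cvf X (- j X) | X. X \<in> vector_fields A}"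
  then obtain X where Z: "Z = mk_cvf X (- j X)" and X: "X \<in> vector_fields A" by blast
  then show "Z \<in> T10_sections A J"
    using j_vector_field[OF X] vector_fields_neg[OF j_vector_field[OF X]]
    by (auto simp: T10_sections_def complexification_eq endo_app_complex_def Re_Im_mk_cvf
        cscale_i_mk_cvf mk_cvf_eq_iff j_minus j_j)
qed

text \<open>The \<open>(0,1)\<close>-part of \<open>P + i Q\<close> is \<open>A\<^sup>- (P - j Q)\<close>, so \<open>P - j Q\<close> measures how far a complex field is from being of
  type \<open>(1,0)\<close>. Writing \<open>P = j Q + F\<close>, this is the measure of the bracket of two complex fields in terms of their
  own measures \<open>F\<close> and \<open>F'\<close>. Both conditions in the definition of a transverse structure appear as terms on the
  right, which is the whole content of the equivalence with involutivity.\<close>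

lemma bracket_01_part:
  assumes Q: "Q \<in> vector_fields A" and Q': "Q' \<in> vector_fields A"
    and F: "F \<in> vector_fields A" and F': "F' \<in> vector_fields A"
  shows "lie_bracket A (j Q + F) (j Q' + F') - lie_bracket A Q Q'
      - j (lie_bracket A (j Q + F) Q' + lie_bracket A Q (j Q' + F')) =
    nijenhuis A J Q Q' + lie_derivative_endo A F J Q' - lie_derivative_endo A F' J Q + lie_bracket A F F'"
proof -
  note vf = Q Q' F F' j_vector_field lie_bracket_vector_field vector_fields_add
  have "lie_bracket A (j Q + F) (j Q' + F') = lie_bracket A (j Q) (j Q') - lie_bracket A F' (j Q)
      + lie_bracket A F (j Q') + lie_bracket A F F'"
    by (simp add: lie_bracket_add_left lie_bracket_add_right vf lie_bracket_antisym[of "j Q" F'])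
  moreover have "j (lie_bracket A (j Q + F) Q' + lie_bracket A Q (j Q' + F')) =
      j (lie_bracket A (j Q) Q') + j (lie_bracket A F Q') + j (lie_bracket A Q (j Q')) - j (lie_bracket A F' Q)"
    by (simp add: lie_bracket_add_left lie_bracket_add_right vf vector_fields_diff j_add j_minus j_diff
        lie_bracket_antisym[of Q F'])
  ultimately show ?thesis
    by (simp only: nijenhuis_def lie_derivative_endo_def) (simp add: algebra_simps)
qed

end

section \<open>Distributions stable under an almost complex structure\<close>

locale stable_distribution = almost_complex_manifold A J
  for A :: "('m::{t2_space, second_countable_topology}, 'e::euclidean_space) chart set"
    and J :: "'m endo_field" +
  fixes \<D> :: "'m vfield set"
  assumes gen: "generalized_involutive_distribution A \<D>" and stable: "stable_under J \<D>"
begin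

lemma subspace_\<D>: "subspace \<D>"
  and \<D>_vector_field: "F \<in> \<D> \<Longrightarrow> F \<in> vector_fields A"
  and \<D>_bracket: "F \<in> \<D> \<Longrightarrow> G \<in> \<D> \<Longrightarrow> lie_bracket A F G \<in> \<D>"
  and \<D>_j: "F \<in> \<D> \<Longrightarrow> j F \<in> \<D>"
  using generalized_involutive_distributionD[OF gen] stable
  by (auto simp: involutive_def stable_under_def)

text \<open>The common value of the three sums in the theorem: the complex fields whose \<open>(0,1)\<close>-part lies in \<open>A\<^sup>- (\<D>)\<close>.\<close>

definition transverse_fields :: "'m cvfield set" where
  "transverse_fields = {mk_cvf P Q | P Q. P \<in> vector_fields A \<and> Q \<in> vector_fields A \<and> P - j Q \<in> \<D>}"

lemma mk_cvf_transverse: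
  "mk_cvf P Q \<in> transverse_fields \<longleftrightarrow> P \<in> vector_fields A \<and> Q \<in> vector_fields A \<and> P - j Q \<in> \<D>"
  by (auto simp: transverse_fields_def mk_cvf_eq_iff)

lemma T10_sum_transverse:
  assumes U: "U \<in> vector_fields A" and F: "F \<in> \<D>" and G: "G \<in> \<D>"
  shows "mk_cvf U (- j U) + mk_cvf F G \<in> transverse_fields"
proof -
  note vf = U \<D>_vector_field[OF F] \<D>_vector_field[OF G] j_vector_field vector_fields_neg vector_fields_add
  have "j (- j U + G) = U + j G"
    by (simp only: j_add j_minus j_j vf minus_minus)
  then have "(U + F) - j (- j U + G) = F - j G"
    by (simp only: add_diff_cancel_left)
  then show ?thesis
    unfolding mk_cvf_add mk_cvf_transverse
    using vf subspace_diff[OF subspace_\<D> F \<D>_j[OF G]] by (simp only:)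
qed

lemma T10_plus_real: "T10_sections A J + of_real_vf ` \<D> = transverse_fields"
proof (intro set_eqI iffI)
  fix Z assume "Z \<in> T10_sections A J + of_real_vf ` \<D>"
  then obtain U F where "U \<in> vector_fields A" "F \<in> \<D>" "Z = mk_cvf U (- j U) + mk_cvf F 0"
    by (auto simp: T10_sections_eq of_real_vf_def elim!: set_plus_elim)
  then show "Z \<in> transverse_fields"
    using T10_sum_transverse[of U F 0] subspace_0[OF subspace_\<D>] by metis
next
  fix Z assume "Z \<in> transverse_fields"
  then obtain P Q where Z: "Z = mk_cvf P Q" and P: "P \<in> vector_fields A" and Q: "Q \<in> vector_fields A"
    and F: "P - j Q \<in> \<D>"
    unfolding transverse_fields_def by blast
  have "Z = mk_cvf (j Q) (- j (j Q)) + of_real_vf (P - j Q)"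
    by (simp add: Z of_real_vf_def mk_cvf_add j_j[OF Q])
  moreover have "mk_cvf (j Q) (- j (j Q)) \<in> T10_sections A J"
    using j_vector_field[OF Q] by (auto simp: T10_sections_eq)
  ultimately show "Z \<in> T10_sections A J + of_real_vf ` \<D>"
    using F by (auto intro: set_plus_intro)
qed

text \<open>The decomposition of \<open>P + i Q\<close> into its \<open>(1,0)\<close>-part \<open>U - i j U\<close>, where \<open>U = (P + j Q)/2\<close>, and its
  \<open>(0,1)\<close>-part.\<close>

lemma T10_plus_A_minus: "T10_sections A J + A_minus J ` \<D> = transverse_fields"
proof (intro set_eqI iffI)
  fix Z assume "Z \<in> T10_sections A J + A_minus J ` \<D>"
  then obtain U F where "U \<in> vector_fields A" "F \<in> \<D>"
      "Z = mk_cvf U (- j U) + mk_cvf ((1/2) *\<^sub>R F) ((1/2) *\<^sub>R j F)"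
    by (auto simp: T10_sections_eq A_minus_eq elim!: set_plus_elim)
  then show "Z \<in> transverse_fields"
    using T10_sum_transverse subspace_scale[OF subspace_\<D>] \<D>_j by metis
next
  fix Z assume "Z \<in> transverse_fields"
  then obtain P Q where Z: "Z = mk_cvf P Q" and P: "P \<in> vector_fields A" and Q: "Q \<in> vector_fields A"
    and F: "P - j Q \<in> \<D>"
    unfolding transverse_fields_def by blast
  define U where "U = (1/2) *\<^sub>R (P + j Q)"
  have U: "U \<in> vector_fields A"
    unfolding U_def by (intro vector_fields_scaleR vector_fields_add P j_vector_field Q)
  have jU: "j U = (1/2) *\<^sub>R (j P - Q)"
    by (simp add: U_def j_scaleR vector_fields_add P j_vector_field Q j_add j_j)
  have jF: "j (P - j Q) = j P + Q"
    by (simp add: j_diff P j_vector_field Q j_j)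
  have "Z = mk_cvf U (- j U) + A_minus J (P - j Q)"
    unfolding Z A_minus_eq mk_cvf_add mk_cvf_eq_iff jU jF unfolding U_def
    by (simp add: fun_eq_iff field_simps)
  moreover have "mk_cvf U (- j U) \<in> T10_sections A J"
    using U by (auto simp: T10_sections_eq)
  ultimately show "Z \<in> T10_sections A J + A_minus J ` \<D>"
    using F by (auto intro: set_plus_intro)
qed

lemma T10_plus_complexification: "T10_sections A J + complexification \<D> = transverse_fields"
proof (intro equalityI subsetI)
  fix Z assume "Z \<in> T10_sections A J + complexification \<D>"
  then show "Z \<in> transverse_fields"
    using T10_sum_transverse by (auto simp: T10_sections_eq complexification_eq elim!: set_plus_elim)
next
  fix Z assume "Z \<in> transverse_fields"
  then have "Z \<in> T10_sections A J + of_real_vf ` \<D>" by (simp only: T10_plus_real)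
  moreover have "of_real_vf ` \<D> \<subseteq> complexification \<D>"
    using subspace_0[OF subspace_\<D>] by (auto simp: complexification_eq of_real_vf_def)
  ultimately show "Z \<in> T10_sections A J + complexification \<D>"
    using set_plus_mono2[OF order_refl] by blast
qed

lemma T10_inter_A_minus: "T10_sections A J \<inter> A_minus J ` \<D> = {0}"
proof (intro equalityI subsetI)
  fix Z assume "Z \<in> T10_sections A J \<inter> A_minus J ` \<D>"
  then obtain U F where Z: "Z = mk_cvf U (- j U)" "Z = mk_cvf ((1/2) *\<^sub>R F) ((1/2) *\<^sub>R j F)" and F: "F \<in> \<D>"
    by (auto simp: T10_sections_eq A_minus_eq)
  then have "U = (1/2) *\<^sub>R F" "- j U = (1/2) *\<^sub>R j F"
    by (metis mk_cvf_eq_iff)+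
  then have "- ((1/2) *\<^sub>R j F) = (1/2) *\<^sub>R j F"
    using j_scaleR[OF \<D>_vector_field[OF F]] by simp
  then have "j F = 0" by (simp add: fun_eq_iff)
  moreover have "F = - j (j F)" using j_j[OF \<D>_vector_field[OF F]] by simp
  ultimately have "F = 0" by (simp add: j_zero)
  then show "Z \<in> {0}" using Z(2) by (simp add: j_zero mk_cvf_zero)
next
  fix Z :: "'m cvfield" assume "Z \<in> {0}"
  then have "Z = mk_cvf 0 (- j 0)" "Z = A_minus J 0"
    by (simp_all add: A_minus_eq j_zero mk_cvf_zero)
  then show "Z \<in> T10_sections A J \<inter> A_minus J ` \<D>"
    using subspace_0[OF subspace_\<D>] subspace_0[OF subspace_vector_fields]
    unfolding T10_sections_eq by blast
qed

lemma bracket_transverse_iff: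
  assumes Q: "Q \<in> vector_fields A" and Q': "Q' \<in> vector_fields A" and F: "F \<in> \<D>" and F': "F' \<in> \<D>"
  shows "lie_bracket_complex A (mk_cvf (j Q + F) Q) (mk_cvf (j Q' + F') Q') \<in> transverse_fields \<longleftrightarrow>
    nijenhuis A J Q Q' + lie_derivative_endo A F J Q' - lie_derivative_endo A F' J Q + lie_bracket A F F' \<in> \<D>"
  unfolding lie_bracket_complex_mk mk_cvf_transverse
  bracket_01_part[OF Q Q' \<D>_vector_field[OF F] \<D>_vector_field[OF F']]
  by (simp add: vector_fields_add vector_fields_diff lie_bracket_vector_field j_vector_field
      Q Q' \<D>_vector_field[OF F] \<D>_vector_field[OF F'])

lemma complex_transverse_structure_eq:
  "complex_transverse_structure A J \<D> \<longleftrightarrow>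
    (\<forall>F\<in>\<D>. \<forall>U\<in>vector_fields A. lie_derivative_endo A F J U \<in> \<D>) \<and>
    (\<forall>U\<in>vector_fields A. \<forall>V\<in>vector_fields A. nijenhuis A J U V \<in> \<D>)"
  unfolding complex_transverse_structure_def lie_derivative_endo_def by (rule refl)

lemma lie_derivative_endo_zero: "U \<in> vector_fields A \<Longrightarrow> lie_derivative_endo A 0 J U = 0"
  using lie_bracket_scaleR_left[OF subspace_0[OF subspace_vector_fields], of _ 0]
  by (simp add: lie_derivative_endo_def j_vector_field j_zero)

lemma nijenhuis_zero_left: "U \<in> vector_fields A \<Longrightarrow> nijenhuis A J 0 U = 0"
  using nijenhuis_sum_left[of "{}" _ U] by simp

text \<open>If the structure is transverse, each term of \<open>bracket_01_part\<close> lies in \<open>\<D>\<close>. Conversely, taking \<open>Q = 0\<close>,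
  \<open>F' = 0\<close> isolates the condition on Lie derivatives, and \<open>F = F' = 0\<close> the one on the Nijenhuis tensor.\<close>

lemma complex_transverse_structure_iff_involutive:
  "complex_transverse_structure A J \<D> \<longleftrightarrow> involutive_complex A transverse_fields"
proof
  assume T: "complex_transverse_structure A J \<D>"
  show "involutive_complex A transverse_fields"
    unfolding involutive_complex_def
  proof (intro ballI)
    fix Z W assume "Z \<in> transverse_fields" "W \<in> transverse_fields"
    then obtain P Q P' Q' where Z: "Z = mk_cvf P Q" "Q \<in> vector_fields A" "P - j Q \<in> \<D>"
      and W: "W = mk_cvf P' Q'" "Q' \<in> vector_fields A" "P' - j Q' \<in> \<D>"
      unfolding transverse_fields_def by blast
    note s = subspace_\<D> and T = T[unfolded complex_transverse_structure_eq]
    have "nijenhuis A J Q Q' \<in> \<D>" "lie_derivative_endo A (P - j Q) J Q' \<in> \<D>"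
        "lie_derivative_endo A (P' - j Q') J Q \<in> \<D>"
      using T Z W by blast+
    note in_\<D> = subspace_add[OF s subspace_diff[OF s subspace_add[OF s this(1,2)] this(3)] \<D>_bracket[OF Z(3) W(3)]]
    have "lie_bracket_complex A (mk_cvf (j Q + (P - j Q)) Q) (mk_cvf (j Q' + (P' - j Q')) Q') \<in> transverse_fields"
      unfolding bracket_transverse_iff[OF Z(2) W(2) Z(3) W(3)] by (rule in_\<D>)
    then show "lie_bracket_complex A Z W \<in> transverse_fields"
      unfolding Z(1) W(1) by (simp only: add_diff_eq add_diff_cancel_left')
  qed
next
  assume I: "involutive_complex A transverse_fields"
  have key: "nijenhuis A J Q Q' + lie_derivative_endo A F J Q' - lie_derivative_endo A 0 J Q + lie_bracket A F 0 \<in> \<D>"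
    if "Q \<in> vector_fields A" "Q' \<in> vector_fields A" "F \<in> \<D>" for Q Q' F
  proof -
    have "mk_cvf (j Q + F) Q \<in> transverse_fields" if "Q \<in> vector_fields A" "F \<in> \<D>" for Q F
      using that by (simp add: mk_cvf_transverse vector_fields_add j_vector_field \<D>_vector_field)
    then show ?thesis
      using I that subspace_0[OF subspace_\<D>] bracket_transverse_iff unfolding involutive_complex_def by metis
  qed
  have [simp]: "lie_bracket A F 0 = 0" if "F \<in> \<D>" for F
    using lie_bracket_scaleR_left[OF subspace_0[OF subspace_vector_fields] \<D>_vector_field[OF that], of 0]
      lie_bracket_antisym[of F 0] by simp
  show "complex_transverse_structure A J \<D>"
    unfolding complex_transverse_structure_eq
  proof (intro conjI ballI)
    fix F U assume FU: "F \<in> \<D>" "U \<in> vector_fields A"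
    from key[OF subspace_0[OF subspace_vector_fields] FU(2,1)]
    show "lie_derivative_endo A F J U \<in> \<D>"
      using FU by (simp add: nijenhuis_zero_left lie_derivative_endo_zero subspace_0[OF subspace_vector_fields])
  next
    fix U V assume UV: "U \<in> vector_fields A" "V \<in> vector_fields A"
    from key[OF UV subspace_0[OF subspace_\<D>]] show "nijenhuis A J U V \<in> \<D>"
      using UV by (simp add: lie_derivative_endo_zero subspace_0[OF subspace_\<D>])
  qed
qed

lemma nijenhuis_sections_subset:
  assumes T: "complex_transverse_structure A J \<D>"
  shows "sections A (nijenhuis_image A J) \<subseteq> \<D>"
proof -
  obtain \<Delta> :: "nat \<Rightarrow> 'm \<Rightarrow> 'm tvec set"
    where sub: "\<And>k x. subspace (\<Delta> k x)" and mono: "mono (\<lambda>k. sections A (\<Delta> k))"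
    and \<D>: "\<D> = (\<Union>k. sections A (\<Delta> k))"
    by (rule generalized_involutive_distributionE[OF gen]) (rule that)
  have "nijenhuis A J X Y \<in> (\<Union>k. sections A (\<Delta> k))"
    if "X \<in> vector_fields A" "Y \<in> vector_fields A" for X Y
    using T that unfolding complex_transverse_structure_def \<D> by blast
  from nijenhuis_image_in_single_level[OF sub mono this]
  obtain k where "\<forall>x. nijenhuis_image A J x \<subseteq> \<Delta> k x" by blast
  then have "sections A (nijenhuis_image A J) \<subseteq> sections A (\<Delta> k)"
    by (auto simp: sections_def)
  then show ?thesis unfolding \<D> by blast
qed

text \<open>\<open>\<D>\<close> contains the sections of the image of the Nijenhuis tensor and is closed under all three operations that
  generate the next derived space: sums, brackets, and \<open>L\<^sub>U j\<close> for \<open>U \<in> \<D>\<close>, by transversality.\<close>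

lemma derived_limit_subset:
  assumes T: "complex_transverse_structure A J \<D>"
  shows "derived_limit A J \<subseteq> \<D>"
proof -
  have "derived_space A J n \<subseteq> \<D>" for n
  proof (induction n)
    case 0
    show ?case using nijenhuis_sections_subset[OF T] by simp
  next
    case (Suc n)
    have "span (\<Union>U\<in>derived_space A J n. lie_derivative_endo A U J ` vector_fields A) \<subseteq> \<D>"
      using T Suc unfolding complex_transverse_structure_eq
      by (intro span_minimal subspace_\<D>) blast
    moreover have "bracket_span A (derived_space A J n) (derived_space A J n) \<subseteq> \<D>"
      unfolding bracket_span_def using Suc \<D>_bracket
      by (intro span_minimal subspace_\<D>) blast
    ultimately have "derived_space A J (Suc n) \<subseteq> \<D> + \<D> + \<D>"
      unfolding derived_space.simps(2) by (intro set_plus_mono2 Suc)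
    moreover have "\<D> + \<D> \<subseteq> \<D>"
      using subspace_add[OF subspace_\<D>] by (auto elim!: set_plus_elim)
    ultimately show ?case
      using set_plus_mono2[of "\<D> + \<D>" \<D> \<D> \<D>] by blast
  qed
  then show ?thesis by (auto simp: derived_limit_def)
qed

end

theorem proposition3p1:
  fixes A :: "('m::{t2_space, second_countable_topology}, 'e::euclidean_space) chart set"
    and J :: "'m endo_field"
    and \<D> :: "'m vfield set"
  assumes "smooth_atlas A"
    and "almost_complex_structure A J"
    and "generalized_involutive_distribution A \<D>"
    and "stable_under J \<D>"
  shows "T10_sections A J + of_real_vf ` \<D> = T10_sections A J + A_minus J ` \<D> \<and>
    T10_sections A J \<inter> A_minus J ` \<D> = {0} \<and>
    T10_sections A J + of_real_vf ` \<D> = T10_sections A J + complexification \<D> \<and>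
    (complex_transverse_structure A J \<D> \<longleftrightarrow>
       involutive_complex A (T10_sections A J + of_real_vf ` \<D>)) \<and>
    (complex_transverse_structure A J \<D> \<longrightarrow>
       derived_limit A J \<subseteq> \<D> \<and> sections A (nijenhuis_image A J) \<subseteq> derived_limit A J)"
proof -
  interpret stable_distribution A J \<D>
    by unfold_locales (use assms in auto)
  have "sections A (nijenhuis_image A J) \<subseteq> derived_limit A J"
    unfolding derived_limit_def using derived_space.simps(1)[of A J] by blast
  then show ?thesis
    unfolding T10_plus_real T10_plus_A_minus T10_plus_complexification
    using T10_inter_A_minus complex_transverse_structure_iff_involutive derived_limit_subset by blast
qed

end
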